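(* Let $\Omega\subset\mathbb{R}^N$ be an open set and let $\psi\in W^{1,\infty}_{loc}(\Omega,\mathbb{R})$ be such that $|\nabla\psi(x)|=1$ for a.e. $x\in\Omega$ and $\nabla\psi\in BV^3_{loc}(\Omega,\mathbb{R}^N)$. Then, for every compactly embedded open subset $\Omega'\subset\subset\Omega$ and every $q\ge1$, we have $\psi\in\mathcal{A}(\Omega',q)$, where $$\mathcal{A}(\Omega',q):=\Big\{\psi\in W^{1,q}(\Omega'):\ \big(\Gamma\text{-}\limsup_{\varepsilon\to0^+}I^{(3)}_\varepsilon\big|_{\Omega'}\big)(\psi)<+\infty\Big\},$$ the $\Gamma$-$\limsup$ being calculated in the $W^{1,q}(\Omega')$ topology. Moreover, $$\big(\Gamma\text{-}\limsup_{\varepsilon\to0^+}I^{(3)}_\varepsilon\big|_{\Omega'}\big)(\psi)\le C\,A_{\nabla\psi,3}(\overline{\Omega'})$$ for some constant $C>0$.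
   Context: $\Omega'\subset\subset\Omega$ means that $\overline{\Omega'}$ is a compact subset of $\Omega$. For scalar functions $\varphi$ on $\Omega'$ and $\varepsilon>0$, $$I^{(3)}_\varepsilon\big|_{\Omega'}(\varphi):=\int_{\Omega'}\Big(\varepsilon^2|\nabla^2\varphi|^3+\frac1\varepsilon\big|1-|\nabla\varphi|^2\big|^{\frac32}\Big)dx$$ (with value $+\infty$ if $\varphi$ does not have a weak Hessian for which the expression is finite). The $\Gamma$-$\limsup$ in the $W^{1,q}(\Omega')$ topology is $\big(\Gamma\text{-}\limsup_{\varepsilon\to0^+}I^{(3)}_\varepsilon|_{\Omega'}\big)(\psi)=\inf\{\limsup_{\varepsilon\to0^+}I^{(3)}_\varepsilon|_{\Omega'}(\psi_\varepsilon):\ \psi_\varepsilon\to\psi \text{ in } W^{1,q}(\Omega')\}$. For an open set $U$ and $v\in L^3_{loc}(U,\mathbb{R}^N)$, let $\bar A_{v,3}(U):=\sup_{\varepsilon\in(0,1)}\int_U\int_{B_\varepsilon(x)\cap U}\frac1{\varepsilon^N}\frac{|v(y)-v(x)|^3}{|y-x|}\,dy\,dx$; $BV^3(U,\mathbb{R}^N)$ is the set of $v\in L^3(U,\mathbb{R}^N)$ with $\bar A_{v,3}(U)<\infty$, and $v\in BV^3_{loc}(\Omega,\mathbb{R}^N)$ means $v\in BV^3(U,\mathbb{R}^N)$ for every open $U\subset\subset\Omega$. Finally $$A_{\nabla\psi,3}(\overline{\Omega'}):=\limsup_{\varepsilon\to0^+}\int_{\overline{\Omega'}}\int_{B_\varepsilon(x)}\frac1{\varepsilon^N}\frac{|\nabla\psi(y)-\nabla\psi(x)|^3}{|y-x|}\,dy\,dx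 .$$ *)

theory Defs
  imports "HOL-Analysis.Analysis"
begin

text \<open>
  Functions on an open set \<open>U\<close> are total functions on \<open>real ^ 'n\<close>; every notion below depends
  only on their values on \<open>U\<close>, up to null sets. Measurability and integrals refer to the
  (complete) Lebesgue measure. Energies take values in the extended nonnegative reals.
\<close>

definition compactly_contained :: "(real ^ 'n) set \<Rightarrow> (real ^ 'n) set \<Rightarrow> bool" (infix "\<subset>\<subset>" 50)
  where "U \<subset>\<subset> V \<longleftrightarrow> compact (closure U) \<and> closure U \<subseteq> V"

subsection \<open>Test functions\<close>

definition partial_deriv :: "'n \<Rightarrow> (real ^ 'n \<Rightarrow> real) \<Rightarrow> real ^ 'n \<Rightarrow> real"
  where "partial_deriv i f x = frechet_derivative f (at x) (axis i 1)"

primrec C_k :: "nat \<Rightarrow> (real ^ 'n \<Rightarrow> real) \<Rightarrow> bool" where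
  "C_k 0 f \<longleftrightarrow> continuous_on UNIV f"
| "C_k (Suc k) f \<longleftrightarrow> (\<forall>x. f differentiable (at x)) \<and> (\<forall>i. C_k k (partial_deriv i f))"

definition test_functions :: "(real ^ 'n) set \<Rightarrow> (real ^ 'n \<Rightarrow> real) set"
  where "test_functions U = {\<eta>. (\<forall>k. C_k k \<eta>) \<and> {x. \<eta> x \<noteq> 0} \<subset>\<subset> U}"

subsection \<open>Lebesgue and Sobolev spaces\<close>

definition L1_loc :: "(real ^ 'n) set \<Rightarrow> (real ^ 'n \<Rightarrow> 'b::{banach, second_countable_topology}) set"
  where "L1_loc U = {f. \<forall>K. compact K \<and> K \<subseteq> U \<longrightarrow> set_integrable lebesgue K f}"

definition Lp :: "(real ^ 'n) set \<Rightarrow> real \<Rightarrow> (real ^ 'n \<Rightarrow> 'b::real_normed_vector) set"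
  where "Lp U p = {f. f \<in> borel_measurable (lebesgue_on U) \<and>
                      (\<integral>\<^sup>+x\<in>U. ennreal (norm (f x) powr p) \<partial>lebesgue) < \<infinity>}"

definition Linf :: "(real ^ 'n) set \<Rightarrow> (real ^ 'n \<Rightarrow> 'b::real_normed_vector) set"
  where "Linf U = {f. f \<in> borel_measurable (lebesgue_on U) \<and>
                      (\<exists>B. AE x in lebesgue_on U. norm (f x) \<le> B)}"

text \<open>Weak derivatives are unique only up to null sets, so they are treated as relations.\<close>

definition has_weak_gradient ::
    "(real ^ 'n) set \<Rightarrow> (real ^ 'n \<Rightarrow> real) \<Rightarrow> (real ^ 'n \<Rightarrow> real ^ 'n) \<Rightarrow> bool"
  where "has_weak_gradient U f g \<longleftrightarrow> f \<in> L1_loc U \<and> g \<in> L1_loc U \<and>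
    (\<forall>\<eta>\<in>test_functions U. \<forall>i.
      (LINT x:U|lebesgue. f x * partial_deriv i \<eta> x) = - (LINT x:U|lebesgue. g x $ i * \<eta> x))"

text \<open>The weak Hessian \<open>H\<close> consists of the weak derivatives of a weak gradient \<open>g\<close>.
  The norm on \<open>real ^ 'n ^ 'n\<close> is the Frobenius norm.\<close>

definition has_weak_hessian :: "(real ^ 'n) set \<Rightarrow> (real ^ 'n \<Rightarrow> real) \<Rightarrow>
    (real ^ 'n \<Rightarrow> real ^ 'n) \<Rightarrow> (real ^ 'n \<Rightarrow> real ^ 'n ^ 'n) \<Rightarrow> bool"
  where "has_weak_hessian U f g H \<longleftrightarrow> has_weak_gradient U f g \<and>
    (\<forall>i. has_weak_gradient U (\<lambda>x. g x $ i) (\<lambda>x. H x $ i))"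

definition W1 :: "(real ^ 'n) set \<Rightarrow> real \<Rightarrow> (real ^ 'n \<Rightarrow> real) set"
  where "W1 U q = {f. f \<in> Lp U q \<and> (\<exists>g. has_weak_gradient U f g \<and> g \<in> Lp U q)}"

definition W1inf :: "(real ^ 'n) set \<Rightarrow> (real ^ 'n \<Rightarrow> real) set"
  where "W1inf U = {f. f \<in> Linf U \<and> (\<exists>g. has_weak_gradient U f g \<and> g \<in> Linf U)}"

definition W1inf_loc :: "(real ^ 'n) set \<Rightarrow> (real ^ 'n \<Rightarrow> real) set"
  where "W1inf_loc \<Omega> = {f. \<forall>U. open U \<and> U \<subset>\<subset> \<Omega> \<longrightarrow> f \<in> W1inf U}"

text \<open>Convergence as \<open>\<epsilon> \<rightarrow> 0+\<close> of a family in \<open>W\<^sup>1\<^sup>,\<^sup>q\<close>: the \<open>q\<close>-th power of the norm of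
  the difference tends to \<open>0\<close>.\<close>

definition W1_tendsto :: "(real ^ 'n) set \<Rightarrow> real \<Rightarrow> (real \<Rightarrow> real ^ 'n \<Rightarrow> real) \<Rightarrow>
    (real ^ 'n \<Rightarrow> real) \<Rightarrow> bool"
  where "W1_tendsto U q u f \<longleftrightarrow> f \<in> W1 U q \<and> (\<forall>\<epsilon>>0. u \<epsilon> \<in> W1 U q) \<and>
    (\<exists>g G. has_weak_gradient U f g \<and> (\<forall>\<epsilon>>0. has_weak_gradient U (u \<epsilon>) (G \<epsilon>)) \<and>
      ((\<lambda>\<epsilon>. \<integral>\<^sup>+x\<in>U. ennreal (\<bar>u \<epsilon> x - f x\<bar> powr q + norm (G \<epsilon> x - g x) powr q) \<partial>lebesgue)
        \<longlongrightarrow> 0) (at_right 0))"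

subsection \<open>The energy, its upper Gamma-limit, and the class of finite upper Gamma-limit\<close>

text \<open>All weak gradients and Hessians of \<open>\<phi>\<close> agree almost everywhere, so the infimum is over at
  most one value; it is \<open>\<infinity>\<close> if there is no weak Hessian.\<close>

definition energy3 :: "(real ^ 'n) set \<Rightarrow> real \<Rightarrow> (real ^ 'n \<Rightarrow> real) \<Rightarrow> ennreal"
  where "energy3 U \<epsilon> \<phi> = (INF (g, H) \<in> {(g, H). has_weak_hessian U \<phi> g H}.
    \<integral>\<^sup>+x\<in>U. ennreal (\<epsilon>\<^sup>2 * norm (H x) ^ 3
                    + 1 / \<epsilon> * \<bar>1 - (norm (g x))\<^sup>2\<bar> powr (3 / 2)) \<partial>lebesgue)"

definition Gamma_limsup_W1 :: "(real ^ 'n) set \<Rightarrow> real \<Rightarrow>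
    (real \<Rightarrow> (real ^ 'n \<Rightarrow> real) \<Rightarrow> ennreal) \<Rightarrow> (real ^ 'n \<Rightarrow> real) \<Rightarrow> ennreal"
  where "Gamma_limsup_W1 U q F \<psi> =
    (INF u \<in> {u. W1_tendsto U q u \<psi>}. Limsup (at_right 0) (\<lambda>\<epsilon>. F \<epsilon> (u \<epsilon>)))"

definition class_A :: "(real ^ 'n) set \<Rightarrow> real \<Rightarrow> (real ^ 'n \<Rightarrow> real) set"
  where "class_A U q = {\<psi> \<in> W1 U q. Gamma_limsup_W1 U q (energy3 U) \<psi> < \<infinity>}"

subsection \<open>The spaces BV^3 and the functional A\<close>

definition A_bar3 :: "(real ^ 'n) set \<Rightarrow> (real ^ 'n \<Rightarrow> real ^ 'n) \<Rightarrow> ennreal"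
  where "A_bar3 U v = (SUP \<epsilon>\<in>{0<..<1}. \<integral>\<^sup>+x\<in>U. (\<integral>\<^sup>+y\<in>ball x \<epsilon> \<inter> U.
    ennreal (1 / \<epsilon> ^ CARD('n) * (norm (v y - v x) ^ 3 / norm (y - x))) \<partial>lebesgue) \<partial>lebesgue)"

definition BV3 :: "(real ^ 'n) set \<Rightarrow> (real ^ 'n \<Rightarrow> real ^ 'n) set"
  where "BV3 U = {v \<in> Lp U 3. A_bar3 U v < \<infinity>}"

definition BV3_loc :: "(real ^ 'n) set \<Rightarrow> (real ^ 'n \<Rightarrow> real ^ 'n) set"
  where "BV3_loc \<Omega> = {v. \<forall>U. open U \<and> U \<subset>\<subset> \<Omega> \<longrightarrow> v \<in> BV3 U}"

text \<open>For compact \<open>K\<close> inside an open set \<open>\<Omega>\<close>, the balls lie in \<open>\<Omega>\<close> for all small \<open>\<epsilon>\<close>, so the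
  upper limit does not depend on the values of \<open>v\<close> outside \<open>\<Omega>\<close>.\<close>

definition A3 :: "(real ^ 'n) set \<Rightarrow> (real ^ 'n \<Rightarrow> real ^ 'n) \<Rightarrow> ennreal"
  where "A3 K v = Limsup (at_right 0) (\<lambda>\<epsilon>. \<integral>\<^sup>+x\<in>K. (\<integral>\<^sup>+y\<in>ball x \<epsilon>.
    ennreal (1 / \<epsilon> ^ CARD('n) * (norm (v y - v x) ^ 3 / norm (y - x))) \<partial>lebesgue) \<partial>lebesgue)"

end

theory Submission
  imports Defs
begin

text \<open>
  The recovery family is the mollification \<open>\<psi>\<^sub>\<epsilon>\<close> of \<open>\<psi>\<close> at scale \<open>\<epsilon>\<close> by a kernel \<open>k\<close> of mass one,
  supported in the ball of radius \<open>\<epsilon>\<close>, with \<open>0 \<le> k \<le> A / \<epsilon>\<^sup>N\<close> and \<open>\<bar>\<nabla>k\<bar> \<le> A / \<epsilon>\<^sup>N\<^sup>+\<^sup>1\<close>. Here \<open>N\<close> is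
  the dimension. Write \<open>v = \<nabla>\<psi>\<close>, so that the gradient of \<open>\<psi>\<^sub>\<epsilon>\<close> is the mollification \<open>G\<close> of \<open>v\<close>, and let \<open>osc\<close> be the
  integral of \<open>\<bar>v(y) - v(x)\<bar>\<^sup>3\<close> over \<open>y\<close> in the ball of radius \<open>\<epsilon>\<close> around \<open>x\<close>. Both terms of the
  energy density at \<open>x\<close> are at most a constant times \<open>osc / \<epsilon>\<^sup>N\<^sup>+\<^sup>1\<close>:

  \<^item> Since \<open>\<nabla>k\<close> has integral zero, the Hessian of \<open>\<psi>\<^sub>\<epsilon>\<close> is, up to sign, the convolution of \<open>\<nabla>k\<close> with
    \<open>v - v(x)\<close>. Its norm is therefore bounded by a constant times \<open>1/\<epsilon>\<close> times the mean of \<open>\<bar>v - v(x)\<bar>\<close>, and the cube of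
    a mean is at most the mean of the cubes (\<open>norm_hessian_le\<close>).
  \<^item> Since \<open>\<bar>v\<bar> = 1\<close>, the number \<open>1 - \<bar>G\<bar>\<^sup>2\<close> is the variance of \<open>v\<close> under the weight \<open>k\<close>, hence at most
    the mean square of \<open>v - v(x)\<close>; its power \<open>3/2\<close> is at most the mean cube (\<open>deficit_le\<close>).

  On the ball, \<open>1/\<epsilon> \<le> 1/\<bar>y - x\<bar>\<close>. So \<open>osc / \<epsilon>\<^sup>N\<^sup>+\<^sup>1\<close> is at most the inner integral that defines
  \<open>A3\<close>, and integration over \<open>x\<close> gives \<open>energy_mollified_le\<close>. The upper limit \<open>A3\<close> is finite
  because for small \<open>\<epsilon>\<close> all the balls lie in one open set \<open>U\<close> that is compactly contained in
  \<open>\<Omega>\<close>, where \<open>v\<close> is of class \<open>BV3\<close> (\<open>A3_le_A_bar3\<close>).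

  Convergence in \<open>W\<^sup>1\<^sup>,\<^sup>q\<close> comes from continuity of translations in \<open>L\<^sup>1\<close>; as \<open>\<psi>\<close> and \<open>v\<close> are bounded,
  \<open>L\<^sup>1\<close> convergence of the mollifications implies \<open>L\<^sup>q\<close> convergence (\<open>mollify_tendsto_Lp\<close>).

  The kernel is only of class \<open>C\<^sup>1\<close>. This suffices because it is never used as a test function: the
  weak gradient of a mollification is found by moving translations onto the given test function
  (\<open>weak_gradient_mollify\<close>), and the weak Hessian by one integration by parts between kernel and
  test function (\<open>weak_gradient_mollify_kernel\<close>).

  For Fubini arguments \<open>\<psi>\<close> and \<open>v\<close>, which are only measurable on \<open>U\<close> with respect to the completed
  measure, are replaced by bounded Borel functions \<open>f\<close> and \<open>w\<close> on the whole space that agree with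
  them almost everywhere on \<open>U\<close>.
\<close>

section \<open>Integration with respect to Lebesgue measure\<close>

lemma nn_integral_lborel_translate:
  fixes f :: "'a::euclidean_space \<Rightarrow> ennreal"
  assumes [measurable]: "f \<in> borel_measurable borel"
  shows "(\<integral>\<^sup>+x. f (c + x) \<partial>lborel) = (\<integral>\<^sup>+x. f x \<partial>lborel)"
  using nn_integral_distr[of "(+) c" lborel borel f] by (simp add: lborel_distr_plus)

lemma integral_lborel_translate:
  fixes f :: "'a::euclidean_space \<Rightarrow> 'b::{banach, second_countable_topology}"
  assumes [measurable]: "f \<in> borel_measurable borel"
  shows "(LINT x|lborel. f (c + x)) = (LINT x|lborel. f x)"
  using integral_distr[of "(+) c" lborel borel f] by (simp add: lborel_distr_plus)

lemma integrable_lborel_translate: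
  fixes f :: "'a::euclidean_space \<Rightarrow> 'b::{banach, second_countable_topology}"
  assumes "integrable lborel f"
  shows "integrable lborel (\<lambda>x. f (c + x))"
proof -
  have "integrable (distr lborel borel ((+) c)) f"
    using assms by (simp add: lborel_distr_plus)
  then show ?thesis by (subst (asm) integrable_distr_eq) (use assms in auto)
qed

lemma integrable_bounded_support:
  fixes f :: "'a::euclidean_space \<Rightarrow> 'b::{banach, second_countable_topology}"
  assumes f: "f \<in> borel_measurable borel" and S: "bounded S"
    and out: "\<And>x. x \<notin> S \<Longrightarrow> f x = 0" and B: "\<And>x. x \<in> S \<Longrightarrow> norm (f x) \<le> B"
  shows "integrable lborel f"
proof -
  obtain R where R: "S \<subseteq> cball 0 R"
    using S bounded_subset_ballD by (metis ball_subset_cball subset_trans)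
  show ?thesis
  proof (rule integrableI_bounded_set[where A="cball 0 R" and B="max B 0"])
    show "emeasure lborel (cball (0::'a) R) < \<infinity>"
      by (intro emeasure_bounded_finite) auto
    show "AE x in lborel. x \<in> cball 0 R \<longrightarrow> norm (f x) \<le> max B 0"
      using out B by (intro AE_I2 impI) (metis max.coboundedI1 max.cobounded2 norm_zero)
    show "AE x in lborel. x \<notin> cball 0 R \<longrightarrow> f x = 0"
      using out R by (intro AE_I2 impI) (metis subsetD)
  qed (use f in auto)
qed

lemma integrable_continuous_bounded_support:
  fixes f :: "'a::euclidean_space \<Rightarrow> 'b::{banach, second_countable_topology}"
  assumes f: "continuous_on UNIV f" and S: "bounded S"
    and out: "\<And>x. x \<notin> S \<Longrightarrow> f x = 0"
  shows "integrable lborel f"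
proof -
  have "compact (f ` closure S)"
    using S by (intro compact_continuous_image continuous_on_subset[OF f]) (auto simp: compact_closure)
  then obtain B where B: "\<And>x. x \<in> closure S \<Longrightarrow> norm (f x) \<le> B"
    using compact_imp_bounded bounded_iff by (metis imageI)
  then show ?thesis
    using closure_subset[of S]
    by (intro integrable_bounded_support[OF _ S out B])
       (auto intro: borel_measurable_continuous_onI[OF f])
qed

text \<open>
  The difference quotients of \<open>f\<close> in the direction \<open>e\<close> have integral zero because Lebesgue
  measure is translation invariant, and they converge boundedly to the directional derivative.
\<close>
lemma integral_derivative_eq_0:
  fixes f :: "'a::euclidean_space \<Rightarrow> real"
  assumes der: "\<And>x. (f has_derivative D x) (at x)"
    and cont: "continuous_on UNIV (\<lambda>x. D x e)"
    and S: "bounded S" and out: "\<And>x. x \<notin> S \<Longrightarrow> f x = 0"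
  shows "(LINT x|lborel. D x e) = 0"
proof -
  obtain R where R: "S \<subseteq> cball 0 R" "R > 0"
    using S bounded_subset_ballD by (metis ball_subset_cball subset_trans)
  define R' where "R' = R + norm e"
  have contf: "continuous_on UNIV f"
    by (meson der differentiable_def differentiable_imp_continuous_on differentiable_on_def
        has_derivative_at_withinI)
  have out': "f x = 0" if "norm x > R" for x
    using out R that by (metis mem_cball_0 not_le subsetD)
  have "bounded ((\<lambda>x. D x e) ` cball 0 R')"
    by (intro compact_imp_bounded compact_continuous_image continuous_on_subset[OF cont]) auto
  then obtain B where B: "\<And>x. norm x \<le> R' \<Longrightarrow> \<bar>D x e\<bar> \<le> B"
    unfolding bounded_iff by force
  have path: "((\<lambda>t. f (x + t *\<^sub>R e)) has_real_derivative D (x + t *\<^sub>R e) e) (at t)" for x t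
  proof -
    have "((\<lambda>t. f (x + t *\<^sub>R e)) has_derivative (\<lambda>h. D (x + t *\<^sub>R e) (h *\<^sub>R e))) (at t)"
      by (rule has_derivative_compose[OF _ der, of "\<lambda>t. x + t *\<^sub>R e"])
         (auto intro!: derivative_eq_intros)
    moreover have "D (x + t *\<^sub>R e) (h *\<^sub>R e) = D (x + t *\<^sub>R e) e * h" for h
      using linear_simps(5)[OF has_derivative_bounded_linear[OF der]] by (simp add: linear_cmul)
    ultimately show ?thesis
      by (simp add: has_field_derivative_def mult.commute[of _ "D _ _"] fun_eq_iff)
  qed
  \<comment> \<open>Outside the ball the derivative vanishes too, so \<open>B\<close> bounds it everywhere.\<close>
  have D0: "D x e = 0" if x: "norm x > R" for x
  proof -
    have op: "open {x::'a. norm x > R}"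
      by (intro open_Collect_less continuous_intros)
    have "(f has_derivative (\<lambda>h. 0)) (at x)"
      using has_derivative_transform_within_open[OF has_derivative_const[of 0] op, of x f]
        x out' by auto
    then show ?thesis
      using has_derivative_unique[OF der] by metis
  qed
  define h :: "nat \<Rightarrow> real" where "h n = 1 / Suc n" for n
  have h: "0 < h n" "h n \<le> 1" for n by (auto simp: h_def)
  have h0: "h \<longlonglongrightarrow> 0"
    unfolding h_def using LIMSEQ_inverse_real_of_nat by (simp add: divide_inverse)
  define s where "s n x = (f (x + h n *\<^sub>R e) - f x) / h n" for n x
  have intf: "integrable lborel f"
    by (rule integrable_continuous_bounded_support[OF contf S out])
  have s0: "(LINT x|lborel. s n x) = 0" for n
    using integral_lborel_translate[of f "h n *\<^sub>R e"] intf
      integrable_lborel_translate[OF intf, of "h n *\<^sub>R e"]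
    by (simp add: s_def add.commute)
  have bound: "\<bar>s n x\<bar> \<le> indicator (cball 0 R') x * B" for n x
  proof (cases "norm x \<le> R'")
    case True
    obtain t where t: "0 < t" "t < h n" "f (x + h n *\<^sub>R e) - f x = h n * D (x + t *\<^sub>R e) e"
      using MVT2[of 0 "h n" "\<lambda>t. f (x + t *\<^sub>R e)" "\<lambda>t. D (x + t *\<^sub>R e) e"] path h[of n] by auto
    then have "s n x = D (x + t *\<^sub>R e) e"
      using h[of n] by (simp add: s_def)
    moreover have "\<bar>D (x + t *\<^sub>R e) e\<bar> \<le> B"
    proof (cases "norm (x + t *\<^sub>R e) \<le> R'")
      case False
      have "norm e \<ge> 0" by simp
      then have "norm (x + t *\<^sub>R e) > R" "0 \<le> R'"
        using False R(2) unfolding R'_def by linarith+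
      then show ?thesis using D0[of "x + t *\<^sub>R e"] B[of 0] by auto
    qed (use B in auto)
    ultimately show ?thesis using True by simp
  next
    case False
    have "norm x \<le> norm (x + h n *\<^sub>R e) + norm (h n *\<^sub>R e)"
      by (metis add_diff_cancel_right' norm_triangle_ineq4)
    moreover have "norm (h n *\<^sub>R e) \<le> norm e"
      using h[of n] by (simp add: mult_left_le_one_le)
    ultimately have "norm (x + h n *\<^sub>R e) > R"
      using False by (simp add: R'_def)
    moreover have "norm x > R"
      using False norm_ge_zero[of e] unfolding R'_def by linarith
    ultimately show ?thesis using False out' by (simp add: s_def)
  qed
  have lim: "(\<lambda>n. s n x) \<longlonglongrightarrow> D x e" for x
  proof -
    have "((\<lambda>t. (f (x + t *\<^sub>R e) - f x) / t) \<longlongrightarrow> D x e) (at 0)"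
      using path[of x 0] by (simp add: DERIV_def)
    moreover have "filterlim h (at 0) sequentially"
      using h0 h by (simp add: filterlim_at less_imp_neq[symmetric] eventually_sequentially order.strict_implies_not_eq)
    ultimately show ?thesis
      unfolding s_def by (rule filterlim_compose)
  qed
  have "(\<lambda>n. LINT x|lborel. s n x) \<longlonglongrightarrow> (LINT x|lborel. D x e)"
  proof (rule integral_dominated_convergence)
    show "integrable lborel (\<lambda>x. indicator (cball 0 R') x * B)"
      by (intro integrable_mult_left integrable_real_indicator emeasure_bounded_finite) auto
    show "s n \<in> borel_measurable lborel" for n
      unfolding s_def using contf by (intro borel_measurable_divide borel_measurable_diff borel_measurable_const)
        (auto intro!: borel_measurable_continuous_onI continuous_on_compose2[OF contf] continuous_intros)
    show "(\<lambda>x. D x e) \<in> borel_measurable lborel"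
      using cont by (auto intro: borel_measurable_continuous_onI)
  qed (use bound lim in auto)
  then show ?thesis by (simp add: s0 LIMSEQ_const_iff)
qed

section \<open>Test functions and mollification\<close>

lemma test_function_support:
  assumes "\<eta> \<in> test_functions U"
  obtains K where "compact K" "K \<subseteq> U" "\<And>x. x \<notin> K \<Longrightarrow> \<eta> x = 0"
    "\<And>x i. x \<notin> K \<Longrightarrow> partial_deriv i \<eta> x = 0"
proof
  let ?K = "closure {x. \<eta> x \<noteq> 0}"
  show "compact ?K" "?K \<subseteq> U"
    using assms by (auto simp: test_functions_def compactly_contained_def)
  show z: "\<eta> x = 0" if "x \<notin> ?K" for x
    using that closure_subset[of "{x. \<eta> x \<noteq> 0}"] by blast
  show "partial_deriv i \<eta> x = 0" if "x \<notin> ?K" for x i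
  proof -
    have "(\<eta> has_derivative (\<lambda>h. 0)) (at x)"
    proof (rule has_derivative_transform_within_open[OF has_derivative_const])
      show "open (- ?K)" by (rule open_Compl[OF closed_closure])
      show "x \<in> - ?K" using that by simp
      show "0 = \<eta> y" if "y \<in> - ?K" for y using that z[of y] by simp
    qed
    then have "frechet_derivative \<eta> (at x) = (\<lambda>h. 0)"
      using frechet_derivative_at by metis
    then show ?thesis by (simp add: partial_deriv_def)
  qed
qed

lemma test_function_smooth:
  assumes "\<eta> \<in> test_functions U"
  shows test_function_has_derivative: "(\<eta> has_derivative frechet_derivative \<eta> (at x)) (at x)"
    and test_function_continuous: "continuous_on UNIV \<eta>"
    and test_function_continuous_partial: "continuous_on UNIV (partial_deriv i \<eta>)"
proof -
  have "C_k 0 \<eta>" "C_k (Suc 0) \<eta>"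
    using assms unfolding test_functions_def by blast+
  then show "(\<eta> has_derivative frechet_derivative \<eta> (at x)) (at x)" "continuous_on UNIV \<eta>"
    "continuous_on UNIV (partial_deriv i \<eta>)"
    by (auto simp: frechet_derivative_works)
qed

lemma test_function_measurable:
  assumes "\<eta> \<in> test_functions U"
  shows "\<eta> \<in> borel_measurable borel"
  by (intro borel_measurable_continuous_onI test_function_continuous[OF assms])

lemma test_function_partial_measurable:
  assumes "\<eta> \<in> test_functions U"
  shows "partial_deriv i \<eta> \<in> borel_measurable borel"
  by (intro borel_measurable_continuous_onI test_function_continuous_partial[OF assms])

lemma test_function_integrable:
  assumes "\<eta> \<in> test_functions U"
  shows "integrable lborel \<eta>" "integrable lborel (partial_deriv i \<eta>)"
proof -
  obtain K where K: "compact K" "\<And>x. x \<notin> K \<Longrightarrow> \<eta> x = 0"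
    "\<And>x i. x \<notin> K \<Longrightarrow> partial_deriv i \<eta> x = 0"
    using test_function_support[OF assms] by metis
  show "integrable lborel \<eta>" "integrable lborel (partial_deriv i \<eta>)"
    by (rule integrable_continuous_bounded_support[OF _ compact_imp_bounded[OF K(1)]];
        simp add: K test_function_smooth[OF assms])+
qed

lemma partial_deriv_translate:
  assumes "\<And>x. f differentiable (at x)"
  shows "partial_deriv i (\<lambda>x. f (x - z)) = (\<lambda>x. partial_deriv i f (x - z))"
proof
  fix x
  have "(f has_derivative frechet_derivative f (at (x - z))) (at (x - z))"
    using assms by (simp add: frechet_derivative_works)
  then have "((\<lambda>x. f (x - z)) has_derivative frechet_derivative f (at (x - z))) (at x)"
    using has_derivative_compose[of "\<lambda>x. x - z" "\<lambda>h. h" x UNIV f]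
      has_derivative_diff[OF has_derivative_ident has_derivative_const[of z]] by simp
  then show "partial_deriv i (\<lambda>x. f (x - z)) x = partial_deriv i f (x - z)"
    unfolding partial_deriv_def by (metis frechet_derivative_at)
qed

lemma C_k_translate: "C_k k f \<Longrightarrow> C_k k (\<lambda>x. f (x - z))"
proof (induction k arbitrary: f)
  case 0
  then show ?case by (auto intro!: continuous_on_compose2[of UNIV f] continuous_intros)
next
  case (Suc k)
  have "(\<lambda>x. f (x - z)) differentiable (at x)" for x
    using Suc.prems by (intro differentiable_chain_at[of "\<lambda>x. x - z" x f, unfolded o_def]) auto
  then show ?case using Suc by (simp add: partial_deriv_translate)
qed

lemma test_function_translate:
  assumes \<eta>: "\<eta> \<in> test_functions V" and z: "\<And>x. x \<in> V \<Longrightarrow> x + z \<in> U"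
  shows "(\<lambda>x. \<eta> (x - z)) \<in> test_functions U"
proof -
  have "{x. \<eta> (x - z) \<noteq> 0} = (+) z ` {x. \<eta> x \<noteq> 0}"
    by (auto simp: image_iff) (metis add.commute diff_add_cancel)
  then have "closure {x. \<eta> (x - z) \<noteq> 0} = (+) z ` closure {x. \<eta> x \<noteq> 0}"
    by (simp add: closure_translation)
  moreover have "compact (closure {x. \<eta> x \<noteq> 0})" "closure {x. \<eta> x \<noteq> 0} \<subseteq> V" "\<forall>k. C_k k \<eta>"
    using \<eta> unfolding test_functions_def compactly_contained_def by blast+
  ultimately show ?thesis
    using z compact_translation[of "closure {x. \<eta> x \<noteq> 0}" z]
    unfolding test_functions_def compactly_contained_def
    by (auto simp: C_k_translate add.commute simp del: compact_closure)
qed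

text \<open>
  The kernel is not reflected: this is convolution with \<open>z \<mapsto> k (- z)\<close>. Hence derivatives
  that fall on the kernel carry a minus sign.
\<close>
definition mollify :: "(real ^ 'n \<Rightarrow> real) \<Rightarrow> (real ^ 'n \<Rightarrow> 'b) \<Rightarrow> real ^ 'n \<Rightarrow> 'b::euclidean_space"
  where "mollify k w x = (LINT z|lborel. k z *\<^sub>R w (x + z))"

lemma mollify_measurable:
  assumes [measurable]: "k \<in> borel_measurable borel" "w \<in> borel_measurable borel"
  shows "mollify k w \<in> borel_measurable borel"
  unfolding mollify_def[abs_def] by measurable

lemma mollify_integrable:
  fixes w :: "real ^ 'n \<Rightarrow> 'b::euclidean_space"
  assumes k: "integrable lborel k" and [measurable]: "w \<in> borel_measurable borel"
    and M: "\<And>x. norm (w x) \<le> M"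
  shows "integrable lborel (\<lambda>z. k z *\<^sub>R w (x + z))"
proof (rule Bochner_Integration.integrable_bound)
  have [measurable]: "k \<in> borel_measurable borel" using k by auto
  show "integrable lborel (\<lambda>z. M * k z)" using k by simp
  show "(\<lambda>z. k z *\<^sub>R w (x + z)) \<in> borel_measurable lborel" by measurable
  show "AE z in lborel. norm (k z *\<^sub>R w (x + z)) \<le> norm (M * k z)"
  proof (intro AE_I2)
    fix z
    have "M \<ge> 0" using M[of 0] norm_ge_zero order_trans by blast
    then show "norm (k z *\<^sub>R w (x + z)) \<le> norm (M * k z)"
      using M[of "x + z"] by (simp add: abs_mult mult.commute[of M] mult_left_mono)
  qed
qed

lemma mollify_norm_le:
  fixes w :: "real ^ 'n \<Rightarrow> 'b::euclidean_space"
  assumes k: "integrable lborel k" and w: "w \<in> borel_measurable borel"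
    and M: "\<And>x. norm (w x) \<le> M"
  shows "norm (mollify k w x) \<le> M * (LINT z|lborel. \<bar>k z\<bar>)"
proof -
  have "norm (mollify k w x) \<le> (LINT z|lborel. norm (k z *\<^sub>R w (x + z)))"
    unfolding mollify_def by (rule integral_norm_bound)
  also have "\<dots> \<le> (LINT z|lborel. M * \<bar>k z\<bar>)"
    using k M by (intro integral_mono integrable_norm mollify_integrable[OF k w M])
      (auto simp: mult.commute[of M] mult_left_mono)
  finally show ?thesis by simp
qed

lemma borel_measurable_nth:
  fixes g :: "'a \<Rightarrow> real ^ 'm"
  assumes "g \<in> borel_measurable N"
  shows "(\<lambda>x. g x $ i) \<in> borel_measurable N"
  by (rule measurable_compose[OF assms])
     (intro borel_measurable_continuous_onI continuous_intros)

lemma mollify_nth: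
  fixes w :: "real ^ 'n \<Rightarrow> real ^ 'm"
  assumes "integrable lborel k" "w \<in> borel_measurable borel" "\<And>x. norm (w x) \<le> M"
  shows "mollify k w x $ i = mollify k (\<lambda>x. w x $ i) x"
  using integral_bounded_linear[OF bounded_linear_vec_nth mollify_integrable[OF assms], of x i]
  by (simp add: mollify_def)

text \<open>
  For each \<open>z\<close> the translation by \<open>a z\<close> leaves the integral of \<open>\<bar>\<phi>\<bar>\<close> unchanged. With
  \<open>a z = 0\<close> and \<open>a z = - z\<close> this covers both applications of Fubini's theorem below.
\<close>
lemma integrable_pair_translate:
  fixes \<phi> \<kappa> :: "'a::euclidean_space \<Rightarrow> real" and F :: "'a \<times> 'a \<Rightarrow> real"
  assumes [measurable]: "F \<in> borel_measurable (lborel \<Otimes>\<^sub>M lborel)"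
    and \<kappa>: "integrable lborel \<kappa>" and \<phi>: "integrable lborel \<phi>"
    and bd: "\<And>z x. \<bar>F (z, x)\<bar> \<le> \<bar>\<kappa> z\<bar> * \<bar>\<phi> (a z + x)\<bar>"
  shows "integrable (lborel \<Otimes>\<^sub>M lborel) F"
proof (rule lborel_pair.Fubini_integrable)
  have inner: "integrable lborel (\<lambda>x. F (z, x))" for z
  proof (rule Bochner_Integration.integrable_bound)
    show "integrable lborel (\<lambda>x. \<kappa> z * \<phi> (a z + x))"
      by (intro integrable_mult_right integrable_lborel_translate \<phi>)
  qed (use bd in \<open>auto simp: abs_mult\<close>)
  then show "AE z in lborel. integrable lborel (\<lambda>x. F (z, x))" by simp
  show "integrable lborel (\<lambda>z. LINT x|lborel. norm (F (z, x)))"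
  proof (rule Bochner_Integration.integrable_bound)
    show "integrable lborel (\<lambda>z. \<kappa> z * (LINT x|lborel. \<bar>\<phi> x\<bar>))"
      using \<kappa> by simp
    have "(LINT x|lborel. norm (F (z, x))) \<le> \<bar>\<kappa> z\<bar> * (LINT x|lborel. \<bar>\<phi> x\<bar>)" for z
    proof -
      have "(LINT x|lborel. norm (F (z, x))) \<le> (LINT x|lborel. \<bar>\<kappa> z\<bar> * \<bar>\<phi> (a z + x)\<bar>)"
        using inner bd \<phi> by (intro integral_mono integrable_mult_right integrable_norm
            integrable_abs integrable_lborel_translate) auto
      also have "\<dots> = \<bar>\<kappa> z\<bar> * (LINT x|lborel. \<bar>\<phi> x\<bar>)"
        using integral_lborel_translate[of "\<lambda>x. \<bar>\<phi> x\<bar>" "a z"] \<phi> by auto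
      finally show ?thesis .
    qed
    then show "AE z in lborel. norm (LINT x|lborel. norm (F (z, x)))
        \<le> norm (\<kappa> z * (LINT x|lborel. \<bar>\<phi> x\<bar>))"
      by (intro AE_I2) (simp add: abs_mult)
  qed measurable
qed measurable

text \<open>
  Two ways to integrate a mollification against \<open>\<phi>\<close>. The first shows the translates of \<open>\<phi>\<close>,
  against which a weak gradient of \<open>f\<close> can be tested. The second puts the kernel and \<open>\<phi>\<close> together, so
  that a derivative can be passed from one to the other.
\<close>
lemma
  fixes f \<kappa> \<phi> :: "real ^ 'n \<Rightarrow> real"
  assumes \<kappa>: "integrable lborel \<kappa>" and f [measurable]: "f \<in> borel_measurable borel"
    and M: "\<And>x. \<bar>f x\<bar> \<le> M" and \<phi>: "integrable lborel \<phi>"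
  shows integral_mollify_translate:
      "(LINT x|lborel. mollify \<kappa> f x * \<phi> x)
        = (LINT z|lborel. \<kappa> z * (LINT y|lborel. f y * \<phi> (y - z)))"
    and integral_mollify_adjoint:
      "(LINT x|lborel. mollify \<kappa> f x * \<phi> x)
        = (LINT y|lborel. f y * (LINT z|lborel. \<kappa> z * \<phi> (y - z)))"
proof -
  have [measurable]: "\<kappa> \<in> borel_measurable borel" "\<phi> \<in> borel_measurable borel"
    using \<kappa> \<phi> by auto
  have M0: "M \<ge> 0" using M[of 0] by linarith
  have "integrable (lborel \<Otimes>\<^sub>M lborel) (\<lambda>(z, x). \<kappa> z * (f (x + z) * \<phi> x))"
    using M M0
    by (intro integrable_pair_translate[OF _ \<kappa> integrable_mult_right[OF \<phi>, of M], of _ "\<lambda>_. 0"])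
       (auto simp: abs_mult intro!: mult_left_mono mult_right_mono)
  then have "(LINT x|lborel. LINT z|lborel. \<kappa> z * (f (x + z) * \<phi> x))
      = (LINT z|lborel. LINT x|lborel. \<kappa> z * (f (x + z) * \<phi> x))"
    by (rule lborel_pair.Fubini_integral)
  also have "(LINT x|lborel. LINT z|lborel. \<kappa> z * (f (x + z) * \<phi> x))
      = (LINT x|lborel. mollify \<kappa> f x * \<phi> x)"
    by (simp add: mollify_def flip: mult.assoc)
  also have "(\<lambda>z. LINT x|lborel. \<kappa> z * (f (x + z) * \<phi> x))
      = (\<lambda>z. \<kappa> z * (LINT y|lborel. f y * \<phi> (y - z)))"
  proof
    fix z
    show "(LINT x|lborel. \<kappa> z * (f (x + z) * \<phi> x)) = \<kappa> z * (LINT y|lborel. f y * \<phi> (y - z))"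
      using integral_lborel_translate[of "\<lambda>y. f y * \<phi> (y - z)" z]
      by (simp add: add.commute[of z])
  qed
  finally show *: "(LINT x|lborel. mollify \<kappa> f x * \<phi> x)
        = (LINT z|lborel. \<kappa> z * (LINT y|lborel. f y * \<phi> (y - z)))" .
  have "integrable (lborel \<Otimes>\<^sub>M lborel) (\<lambda>(z, y). \<kappa> z * (f y * \<phi> (y - z)))"
    using M M0
    by (intro integrable_pair_translate[OF _ \<kappa> integrable_mult_right[OF \<phi>, of M], of _ uminus])
       (auto simp: abs_mult intro!: mult_left_mono mult_right_mono)
  then have "(LINT y|lborel. LINT z|lborel. \<kappa> z * (f y * \<phi> (y - z)))
      = (LINT z|lborel. LINT y|lborel. \<kappa> z * (f y * \<phi> (y - z)))"
    by (rule lborel_pair.Fubini_integral)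
  moreover have "(LINT z|lborel. \<kappa> z * (f y * \<phi> (y - z)))
      = f y * (LINT z|lborel. \<kappa> z * \<phi> (y - z))" for y
    by (simp add: mult.left_commute[of _ "f y"])
  ultimately show "(LINT x|lborel. mollify \<kappa> f x * \<phi> x)
        = (LINT y|lborel. f y * (LINT z|lborel. \<kappa> z * \<phi> (y - z)))"
    by (simp add: *)
qed

lemma set_integral_lebesgue_eq_lborel:
  fixes h :: "'a::euclidean_space \<Rightarrow> 'b::{banach, second_countable_topology}"
  assumes "h \<in> borel_measurable borel" "\<And>x. x \<notin> V \<Longrightarrow> h x = 0"
  shows "(LINT x:V|lebesgue. h x) = (LINT x|lborel. h x)"
proof -
  have "(\<lambda>x. indicat_real V x *\<^sub>R h x) = h"
    using assms by (auto simp: indicator_def)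
  then show ?thesis
    using assms by (simp add: set_lebesgue_integral_def integral_completion)
qed

lemma bounded_measurable_L1_loc:
  fixes h :: "real ^ 'n \<Rightarrow> 'b::euclidean_space"
  assumes "h \<in> borel_measurable borel" "\<And>x. norm (h x) \<le> M"
  shows "h \<in> L1_loc V"
  unfolding L1_loc_def
proof (safe)
  fix K :: "(real ^ 'n) set" assume K: "compact K"
  have "h absolutely_integrable_on K"
    unfolding set_integrable_def
  proof (rule integrableI_bounded_set[where A=K and B=M])
    show "(\<lambda>x. indicat_real K x *\<^sub>R h x) \<in> borel_measurable lebesgue"
      using assms(1) K
      by (intro borel_measurable_scaleR borel_measurable_indicator measurable_completion)
         (auto simp: compact_imp_closed)
    show "emeasure lebesgue K < \<infinity>"
      using K emeasure_bounded_finite[OF compact_imp_bounded[OF K]]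
      by (simp add: compact_imp_closed)
    show "K \<in> sets lebesgue" using K by (simp add: compact_imp_closed)
    show "AE x in lebesgue. x \<in> K \<longrightarrow> norm (indicat_real K x *\<^sub>R h x) \<le> M"
      using assms(2) by (intro AE_I2) simp
  qed simp
  then show "set_integrable lebesgue K h" .
qed

text \<open>
  For each fixed \<open>z\<close> in the support of the kernel, the translate of a test function on \<open>V\<close> by
  \<open>z\<close> is a test function on \<open>U\<close>, where the weak gradient of \<open>f\<close> is known. Averaging over \<open>z\<close> gives the
  claim.
\<close>
lemma weak_gradient_mollify:
  fixes f :: "real ^ 'n \<Rightarrow> real" and g :: "real ^ 'n \<Rightarrow> real ^ 'n"
  assumes k: "integrable lborel k" and supp: "\<And>z. norm z \<ge> r \<Longrightarrow> k z = 0"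
    and f [measurable]: "f \<in> borel_measurable borel" and fM: "\<And>x. \<bar>f x\<bar> \<le> M"
    and g [measurable]: "g \<in> borel_measurable borel" and gM: "\<And>x. norm (g x) \<le> M"
    and weak: "\<And>\<eta> i. \<eta> \<in> test_functions U \<Longrightarrow>
      (LINT x|lborel. f x * partial_deriv i \<eta> x) = - (LINT x|lborel. g x $ i * \<eta> x)"
    and near: "\<And>x z. x \<in> V \<Longrightarrow> norm z < r \<Longrightarrow> x + z \<in> U"
  shows "has_weak_gradient V (mollify k f) (mollify k g)"
  unfolding has_weak_gradient_def
proof (intro conjI ballI allI)
  have [measurable]: "k \<in> borel_measurable borel" using k by auto
  have fM': "norm (f x) \<le> M" for x using fM by simp
  show "mollify k f \<in> L1_loc V" "mollify k g \<in> L1_loc V"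
    using bounded_measurable_L1_loc[OF mollify_measurable mollify_norm_le[OF k f fM']]
      bounded_measurable_L1_loc[OF mollify_measurable mollify_norm_le[OF k g gM]] by auto
  fix \<eta> :: "real ^ 'n \<Rightarrow> real" and i assume \<eta>: "\<eta> \<in> test_functions V"
  note [measurable] = test_function_measurable[OF \<eta>] test_function_partial_measurable[OF \<eta>]
    mollify_measurable borel_measurable_nth[OF g]
  obtain K where K: "compact K" "K \<subseteq> V" "\<And>x. x \<notin> K \<Longrightarrow> \<eta> x = 0"
    "\<And>x i. x \<notin> K \<Longrightarrow> partial_deriv i \<eta> x = 0"
    using test_function_support[OF \<eta>] by metis
  have giM: "\<bar>g x $ i\<bar> \<le> M" for x
    using gM[of x] component_le_norm_cart[of "g x" i] by linarith
  have diff: "\<eta> differentiable (at x)" for x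
    using test_function_has_derivative[OF \<eta>] by (auto simp: differentiable_def)
  have "(LINT x:V|lebesgue. mollify k f x * partial_deriv i \<eta> x)
      = (LINT x|lborel. mollify k f x * partial_deriv i \<eta> x)"
    using K by (intro set_integral_lebesgue_eq_lborel) auto
  also have "\<dots> = (LINT z|lborel. k z * (LINT y|lborel. f y * partial_deriv i \<eta> (y - z)))"
    by (rule integral_mollify_translate[OF k f fM test_function_integrable(2)[OF \<eta>]])
  also have "\<dots> = (LINT z|lborel. k z * - (LINT y|lborel. g y $ i * \<eta> (y - z)))"
  proof (intro Bochner_Integration.integral_cong refl)
    fix z
    show "k z * (LINT y|lborel. f y * partial_deriv i \<eta> (y - z))
        = k z * - (LINT y|lborel. g y $ i * \<eta> (y - z))"
    proof (cases "norm z < r")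
      case True
      then have "(\<lambda>y. \<eta> (y - z)) \<in> test_functions U"
        by (intro test_function_translate[OF \<eta>] near)
      from weak[OF this, of i] show ?thesis
        by (simp add: partial_deriv_translate[OF diff])
    qed (use supp in auto)
  qed
  also have "\<dots> = - (LINT z|lborel. k z * (LINT y|lborel. g y $ i * \<eta> (y - z)))"
    by simp
  also have "\<dots> = - (LINT x|lborel. mollify k (\<lambda>x. g x $ i) x * \<eta> x)"
    by (subst integral_mollify_translate[OF k borel_measurable_nth[OF g] giM
        test_function_integrable(1)[OF \<eta>]]) auto
  also have "\<dots> = - (LINT x:V|lebesgue. mollify k g x $ i * \<eta> x)"
    using K by (subst set_integral_lebesgue_eq_lborel) (auto simp: mollify_nth[OF k g gM])
  finally show "(LINT x:V|lebesgue. mollify k f x * partial_deriv i \<eta> x)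
      = - (LINT x:V|lebesgue. mollify k g x $ i * \<eta> x)" .
qed

text \<open>
  Here the derivative falls on the kernel. The product
  \<open>k(z) \<eta>(y - z)\<close> is differentiable in \<open>z\<close> with compact support, so its partial derivatives
  integrate to zero. This is the integration by parts \<open>parts\<close> in the proof.
\<close>
lemma weak_gradient_mollify_kernel:
  fixes f :: "real ^ 'n \<Rightarrow> real" and k :: "real ^ 'n \<Rightarrow> real" and dk :: "real ^ 'n \<Rightarrow> real ^ 'n"
  assumes der: "\<And>z. (k has_derivative (\<lambda>h. dk z \<bullet> h)) (at z)" and dk: "continuous_on UNIV dk"
    and supp: "\<And>z. norm z \<ge> r \<Longrightarrow> k z = 0" "\<And>z. norm z \<ge> r \<Longrightarrow> dk z = 0"
    and f [measurable]: "f \<in> borel_measurable borel" and fM: "\<And>x. \<bar>f x\<bar> \<le> M"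
  shows "has_weak_gradient V (mollify k f) (\<lambda>x. \<chi> j. - mollify (\<lambda>z. dk z $ j) f x)"
  unfolding has_weak_gradient_def
proof (intro conjI ballI allI)
  have fM': "norm (f x) \<le> M" for x using fM by simp
  have k: "continuous_on UNIV k"
    by (meson der differentiable_def differentiable_imp_continuous_on differentiable_on_def
        has_derivative_at_withinI)
  have dkj: "continuous_on UNIV (\<lambda>z. dk z $ j)" for j
    using dk by (intro continuous_intros)
  have ki: "integrable lborel k"
    by (rule integrable_continuous_bounded_support[OF k bounded_ball[of 0 r]]) (use supp in auto)
  have dki: "integrable lborel (\<lambda>z. dk z $ j)" for j
    by (rule integrable_continuous_bounded_support[OF dkj bounded_ball[of 0 r]]) (use supp in auto)
  have [measurable]: "k \<in> borel_measurable borel" "\<And>j. (\<lambda>z. dk z $ j) \<in> borel_measurable borel"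
    using k dkj by (auto intro: borel_measurable_continuous_onI)
  note [measurable] = mollify_measurable
  show "mollify k f \<in> L1_loc V"
    using bounded_measurable_L1_loc[OF mollify_measurable mollify_norm_le[OF ki f fM']] by auto
  let ?D = "\<lambda>x. \<chi> j. - mollify (\<lambda>z. dk z $ j) f x"
  show "?D \<in> L1_loc V"
  proof (rule bounded_measurable_L1_loc)
    show "?D \<in> borel_measurable borel"
      by (subst borel_measurable_euclidean_space) (auto simp: Basis_vec_def inner_axis)
    show "norm (?D x) \<le> (\<Sum>j\<in>UNIV. M * (LINT z|lborel. \<bar>dk z $ j\<bar>))" for x
      by (rule order_trans[OF norm_le_l1_cart])
         (use mollify_norm_le[OF dki f fM'] in \<open>auto intro!: sum_mono\<close>)
  qed
  fix \<eta> :: "real ^ 'n \<Rightarrow> real" and j assume \<eta>: "\<eta> \<in> test_functions V"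
  note [measurable] = test_function_measurable[OF \<eta>] test_function_partial_measurable[OF \<eta>]
  obtain K where K: "compact K" "K \<subseteq> V" "\<And>x. x \<notin> K \<Longrightarrow> \<eta> x = 0"
    "\<And>x i. x \<notin> K \<Longrightarrow> partial_deriv i \<eta> x = 0"
    using test_function_support[OF \<eta>] by metis
  have parts: "(LINT z|lborel. k z * partial_deriv j \<eta> (y - z)) = (LINT z|lborel. dk z $ j * \<eta> (y - z))" for y
  proof -
    note cont = continuous_on_compose2[OF test_function_continuous[OF \<eta>]]
      continuous_on_compose2[OF test_function_continuous_partial[OF \<eta>]]
    define D where "D z h = k z * - frechet_derivative \<eta> (at (y - z)) h + (dk z \<bullet> h) * \<eta> (y - z)" for z h
    have lin: "linear (frechet_derivative \<eta> (at x))" for x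
      using test_function_has_derivative[OF \<eta>] by (rule has_derivative_linear)
    have e: "D z (axis j 1) = dk z $ j * \<eta> (y - z) - k z * partial_deriv j \<eta> (y - z)" for z
      by (simp add: D_def partial_deriv_def inner_axis)
    have d: "((\<lambda>z. k z * \<eta> (y - z)) has_derivative D z) (at z)" for z
    proof -
      have "((\<lambda>z. \<eta> (y - z)) has_derivative (\<lambda>h. frechet_derivative \<eta> (at (y - z)) (- h))) (at z)"
        by (rule has_derivative_compose[OF _ test_function_has_derivative[OF \<eta>]])
           (auto intro!: derivative_eq_intros)
      then have "((\<lambda>z. k z * \<eta> (y - z)) has_derivative
          (\<lambda>h. k z * frechet_derivative \<eta> (at (y - z)) (- h) + dk z \<bullet> h * \<eta> (y - z))) (at z)"
        by (rule has_derivative_mult[OF der])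
      then show ?thesis
        by (rule has_derivative_eq_rhs) (simp add: D_def fun_eq_iff linear_neg[OF lin])
    qed
    have 1: "integrable lborel (\<lambda>z. dk z $ j * \<eta> (y - z))"
      by (rule integrable_continuous_bounded_support[OF _ bounded_ball[of 0 r]])
         (use supp in \<open>auto intro!: continuous_intros dkj cont\<close>)
    have 2: "integrable lborel (\<lambda>z. k z * partial_deriv j \<eta> (y - z))"
      by (rule integrable_continuous_bounded_support[OF _ bounded_ball[of 0 r]])
         (use supp in \<open>auto intro!: continuous_intros k cont\<close>)
    have "(LINT z|lborel. D z (axis j 1)) = 0"
    proof (rule integral_derivative_eq_0[OF d])
      show "continuous_on UNIV (\<lambda>z. D z (axis j 1))"
        unfolding e by (intro continuous_intros dkj k cont) auto
      show "bounded (ball (0::real^'n) r)" by simp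
    qed (use supp in auto)
    then show ?thesis
      unfolding e using 1 2 by simp
  qed
  have "(LINT x:V|lebesgue. mollify k f x * partial_deriv j \<eta> x)
      = (LINT x|lborel. mollify k f x * partial_deriv j \<eta> x)"
    using K by (intro set_integral_lebesgue_eq_lborel) auto
  also have "\<dots> = (LINT y|lborel. f y * (LINT z|lborel. dk z $ j * \<eta> (y - z)))"
    by (simp add: integral_mollify_adjoint[OF ki f fM test_function_integrable(2)[OF \<eta>]] parts)
  also have "\<dots> = (LINT x|lborel. mollify (\<lambda>z. dk z $ j) f x * \<eta> x)"
    by (simp add: integral_mollify_adjoint[OF dki f fM test_function_integrable(1)[OF \<eta>]])
  also have "\<dots> = (LINT x:V|lebesgue. mollify (\<lambda>z. dk z $ j) f x * \<eta> x)"
    using K by (intro set_integral_lebesgue_eq_lborel[symmetric]) auto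
  finally show "(LINT x:V|lebesgue. mollify k f x * partial_deriv j \<eta> x)
      = - (LINT x:V|lebesgue. ?D x $ j * \<eta> x)"
    by (simp add: set_lebesgue_integral_def)
qed

section \<open>The mollifier and pointwise energy bounds\<close>

text \<open>
  The remainder of the first order expansion lies between \<open>0\<close> and \<open>(s - t)\<^sup>2\<close>, also where the
  signs of \<open>s\<close> and \<open>t\<close> differ.
\<close>
lemma has_derivative_pos_part_squared:
  "((\<lambda>t::real. (max 0 t)\<^sup>2) has_derivative (\<lambda>h. 2 * max 0 t * h)) (at t)"
proof (rule has_derivativeI_sandwich[where e=1 and H="\<lambda>s. \<bar>s - t\<bar>"])
  show "bounded_linear (\<lambda>h. 2 * max 0 t * h)" by (rule bounded_linear_mult_right)
  show "norm ((max 0 s)\<^sup>2 - (max 0 t)\<^sup>2 - 2 * max 0 t * (s - t)) / norm (s - t) \<le> \<bar>s - t\<bar>"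
    if "s \<noteq> t" for s
  proof -
    have "\<bar>(max 0 s)\<^sup>2 - (max 0 t)\<^sup>2 - 2 * max 0 t * (s - t)\<bar> \<le> (s - t)\<^sup>2"
    proof (cases "0 \<le> s"; cases "0 \<le> t")
      assume "0 \<le> s" "0 \<le> t"
      then have "(max 0 s)\<^sup>2 - (max 0 t)\<^sup>2 - 2 * max 0 t * (s - t) = (s - t)\<^sup>2"
        by (simp add: max_def power2_eq_square algebra_simps)
      then show ?thesis by simp
    next
      assume st: "0 \<le> s" "\<not> 0 \<le> t"
      then have "s\<^sup>2 \<le> (s - t)\<^sup>2" by (intro power_mono) auto
      then show ?thesis using st by (simp add: max_def)
    next
      assume st: "\<not> 0 \<le> s" "0 \<le> t"
      then have eq: "(max 0 s)\<^sup>2 - (max 0 t)\<^sup>2 - 2 * max 0 t * (s - t) = t * (t - 2 * s)"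
        by (simp add: max_def power2_eq_square algebra_simps)
      have "0 \<le> t * (t - 2 * s)" using st by (intro mult_nonneg_nonneg) auto
      moreover have "t * (t - 2 * s) + s\<^sup>2 = (s - t)\<^sup>2"
        by (simp add: power2_eq_square algebra_simps)
      ultimately show ?thesis unfolding eq using zero_le_power2[of s] by linarith
    qed auto
    then show ?thesis
      using that by (simp add: divide_le_eq power2_eq_square)
  qed
  show "((\<lambda>s. \<bar>s - t\<bar>) \<longlongrightarrow> 0) (at t)"
    by (auto intro!: tendsto_eq_intros)
qed simp

text \<open>
  A \<open>C\<^sup>1\<close> kernel of mass one at scale \<open>\<epsilon>\<close>, with gradient \<open>dk\<close>. The constant \<open>A\<close> is kept as a
  parameter because the final bound requires it to be the same for all \<open>\<epsilon>\<close>.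
\<close>
locale mollifier =
  fixes A \<epsilon> :: real and k :: "real ^ 'n \<Rightarrow> real" and dk :: "real ^ 'n \<Rightarrow> real ^ 'n"
  assumes A_pos: "0 < A" and eps_pos: "0 < \<epsilon>"
    and der: "\<And>z. (k has_derivative (\<lambda>h. dk z \<bullet> h)) (at z)"
    and dk_cont: "continuous_on UNIV dk"
    and k_support: "\<And>z. \<epsilon> \<le> norm z \<Longrightarrow> k z = 0"
    and dk_support: "\<And>z. \<epsilon> \<le> norm z \<Longrightarrow> dk z = 0"
    and k_nonneg: "\<And>z. 0 \<le> k z"
    and k_le: "\<And>z. k z \<le> A / \<epsilon> ^ CARD('n)"
    and dk_le: "\<And>z. norm (dk z) \<le> A / \<epsilon> ^ Suc CARD('n)"
    and k_integral: "(LINT z|lborel. k z) = 1"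

text \<open>
  The kernel is \<open>(max 0 (\<epsilon>\<^sup>2 - \<bar>z\<bar>\<^sup>2))\<^sup>2\<close> divided by its integral \<open>I\<close>. The function is at least
  \<open>(3\<epsilon>\<^sup>2/4)\<^sup>2\<close> on the ball of radius \<open>\<epsilon>/2\<close>, so \<open>I\<close> is at least a multiple of \<open>\<epsilon>\<^sup>N\<^sup>+\<^sup>4\<close>; this makes
  the bounds uniform in \<open>\<epsilon>\<close>.
\<close>
lemma mollifier_exists:
  obtains A :: real where "\<And>\<epsilon>. 0 < \<epsilon> \<Longrightarrow>
    \<exists>(k :: real ^ 'n \<Rightarrow> real) dk. mollifier A \<epsilon> k dk"
proof -
  define N where "N = CARD('n)"
  define b where "b = 9 / 16 * (unit_ball_vol (real N) / 2 ^ N)"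
  have b: "b > 0" by (simp add: b_def)
  have "\<exists>(k :: real ^ 'n \<Rightarrow> real) dk. mollifier (4 / b) \<epsilon> k dk" if e: "0 < \<epsilon>" for \<epsilon>
  proof -
    define q :: "real ^ 'n \<Rightarrow> real" where "q z = max 0 (\<epsilon>\<^sup>2 - z \<bullet> z)" for z
    define I where "I = (LINT z|lborel. (q z)\<^sup>2)"
    have q0: "q z = 0" if "norm z \<ge> \<epsilon>" for z
      using power_mono[OF that, of 2] e by (simp add: q_def dot_square_norm)
    have qle: "0 \<le> q z" "q z \<le> \<epsilon>\<^sup>2" for z
      by (auto simp: q_def)
    have qcont: "continuous_on UNIV q"
      unfolding q_def by (intro continuous_intros)
    have qder: "((\<lambda>z. (q z)\<^sup>2) has_derivative (\<lambda>h. ((- 4 * q z) *\<^sub>R z) \<bullet> h)) (at z)" for z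
    proof -
      have "((\<lambda>z. (max 0 (\<epsilon>\<^sup>2 - z \<bullet> z))\<^sup>2) has_derivative
          (\<lambda>h. 2 * max 0 (\<epsilon>\<^sup>2 - z \<bullet> z) * (- (z \<bullet> h + h \<bullet> z)))) (at z)"
        by (rule has_derivative_compose[OF _ has_derivative_pos_part_squared])
           (auto intro!: derivative_eq_intros)
      then show ?thesis
        unfolding q_def by (rule has_derivative_eq_rhs) (simp add: fun_eq_iff inner_commute algebra_simps)
    qed
    have q2int: "integrable lborel (\<lambda>z. (q z)\<^sup>2)"
      by (rule integrable_continuous_bounded_support[OF _ bounded_ball[of 0 \<epsilon>]])
         (use q0 qcont in \<open>auto intro!: continuous_intros\<close>)
    have I: "b * \<epsilon> ^ (N + 4) \<le> I"
    proof -
      have "b * \<epsilon> ^ (N + 4) = (9 / 16 * \<epsilon> ^ 4) * measure lborel (cball (0 :: real ^ 'n) (\<epsilon> / 2))"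
        using e by (simp add: b_def content_cball N_def power_add power_divide)
      also have "\<dots> = (LINT z|lborel. indicator (cball (0 :: real ^ 'n) (\<epsilon> / 2)) z * (9 / 16 * \<epsilon> ^ 4))"
        by simp
      also have "\<dots> \<le> I"
        unfolding I_def
      proof (rule integral_mono[OF _ q2int])
        show "integrable lborel (\<lambda>z. indicator (cball (0 :: real ^ 'n) (\<epsilon> / 2)) z * (9 / 16 * \<epsilon> ^ 4))"
          by (intro integrable_mult_left integrable_real_indicator emeasure_bounded_finite) auto
        show "indicator (cball 0 (\<epsilon> / 2)) z * (9 / 16 * \<epsilon> ^ 4) \<le> (q z)\<^sup>2" for z
        proof (cases "norm z \<le> \<epsilon> / 2")
          case True
          from power_mono[OF this, of 2] have "z \<bullet> z \<le> \<epsilon>\<^sup>2 / 4"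
            by (simp add: dot_square_norm power_divide)
          then have "3 / 4 * \<epsilon>\<^sup>2 \<le> q z" by (simp add: q_def le_max_iff_disj)
          from power_mono[OF this, of 2] have "(3 / 4 * \<epsilon>\<^sup>2)\<^sup>2 \<le> (q z)\<^sup>2" by simp
          then show ?thesis using True by (simp add: power_mult_distrib power_divide)
        qed simp
      qed
      finally show ?thesis .
    qed
    have bpos: "0 < b * \<epsilon> ^ (N + 4)" using b e by simp
    then have Ipos: "I > 0" using I by linarith
    define k where "k z = (q z)\<^sup>2 / I" for z
    define dk where "dk z = ((- 4 * q z) / I) *\<^sub>R z" for z
    have "mollifier (4 / b) \<epsilon> k dk"
    proof
      show "(k has_derivative (\<lambda>h. dk z \<bullet> h)) (at z)" for z
        unfolding k_def dk_def
        using has_derivative_mult_right[OF qder[of z], of "1 / I"]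
        by (simp add: divide_inverse mult_ac)
      show "continuous_on UNIV dk"
        unfolding dk_def using Ipos by (intro continuous_intros qcont) auto
      show "k z \<le> 4 / b / \<epsilon> ^ CARD('n)" for z
      proof -
        have "(q z)\<^sup>2 \<le> (\<epsilon>\<^sup>2)\<^sup>2" by (intro power_mono qle)
        then have "k z \<le> \<epsilon> ^ 4 / (b * \<epsilon> ^ (N + 4))"
          unfolding k_def using I bpos by (intro frac_le) auto
        also have "\<dots> = 1 / b / \<epsilon> ^ N"
          using e by (simp add: power_add)
        also have "\<dots> \<le> 4 / b / \<epsilon> ^ N"
          using b e by (intro divide_right_mono) auto
        finally show ?thesis by (simp add: N_def)
      qed
      show "norm (dk z) \<le> 4 / b / \<epsilon> ^ Suc CARD('n)" for z
      proof (cases "norm z \<le> \<epsilon>")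
        case True
        have "norm (dk z) = 4 * q z * norm z / I"
          using qle[of z] Ipos by (simp add: dk_def)
        also have "\<dots> \<le> (4 * \<epsilon>\<^sup>2 * \<epsilon>) / (b * \<epsilon> ^ (N + 4))"
          using True qle[of z] bpos e I by (intro frac_le mult_mono) auto
        also have "\<dots> = 4 / b / \<epsilon> ^ Suc N"
          using e b by (simp add: power_add field_simps power2_eq_square eval_nat_numeral)
        finally show ?thesis by (simp add: N_def)
      qed (use q0[of z] e b in \<open>auto simp: dk_def\<close>)
      show "(LINT z|lborel. k z) = 1"
        unfolding k_def using Ipos by (simp add: I_def)
    qed (use e b q0 Ipos in \<open>auto simp: k_def dk_def\<close>)
    then show ?thesis by blast
  qed
  then show ?thesis using that by blast
qed

text \<open>
  Jensen's inequality for the cube, with the tangent at the mean \<open>m\<close>: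
  \<open>t\<^sup>3 - 3m\<^sup>2t + 2m\<^sup>3 = (t - m)\<^sup>2(t + 2m) \<ge> 0\<close>.
\<close>
lemma cube_mean_le_mean_cube:
  fixes \<omega> t :: "'a \<Rightarrow> real"
  assumes \<omega>: "integrable M \<omega>" "\<And>x. 0 \<le> \<omega> x"
    and t1: "integrable M (\<lambda>x. \<omega> x * t x)" and t3: "integrable M (\<lambda>x. \<omega> x * t x ^ 3)"
    and t: "\<And>x. 0 \<le> t x"
  shows "(LINT x|M. \<omega> x * t x) ^ 3 \<le> (LINT x|M. \<omega> x)\<^sup>2 * (LINT x|M. \<omega> x * t x ^ 3)"
proof (cases "(LINT x|M. \<omega> x) = 0")
  case True
  then have "AE x in M. \<omega> x = 0"
    using \<omega> by (simp add: integral_nonneg_eq_0_iff_AE)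
  then have "(LINT x|M. \<omega> x * t x) = (LINT x|M. 0)"
    using t1 by (intro integral_cong_AE) (auto simp: borel_measurable_integrable)
  then show ?thesis using True by simp
next
  case False
  define W where "W = (LINT x|M. \<omega> x)"
  have W: "W > 0"
    using False \<omega>(2) Bochner_Integration.integral_nonneg unfolding W_def by (simp add: less_le)
  define m where "m = (LINT x|M. \<omega> x * t x) / W"
  have m: "0 \<le> m"
    unfolding m_def using W \<omega> t by (intro divide_nonneg_pos Bochner_Integration.integral_nonneg) auto
  have "m ^ 3 * W = (LINT x|M. 3 * m\<^sup>2 * (\<omega> x * t x) - 2 * m ^ 3 * \<omega> x)"
  proof -
    have "(LINT x|M. 3 * m\<^sup>2 * (\<omega> x * t x) - 2 * m ^ 3 * \<omega> x) = 3 * m\<^sup>2 * (m * W) - 2 * m ^ 3 * W"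
      using t1 \<omega> W by (simp add: m_def W_def)
    then show ?thesis
      by (simp add: power2_eq_square power3_eq_cube)
  qed
  also have "\<dots> \<le> (LINT x|M. \<omega> x * t x ^ 3)"
  proof (rule integral_mono)
    fix x
    have "0 \<le> \<omega> x * ((t x - m)\<^sup>2 * (t x + 2 * m))"
      using \<omega>(2)[of x] t[of x] m by (intro mult_nonneg_nonneg) auto
    then show "3 * m\<^sup>2 * (\<omega> x * t x) - 2 * m ^ 3 * \<omega> x \<le> \<omega> x * t x ^ 3"
      by (simp add: power2_eq_square power3_eq_cube algebra_simps)
  qed (use t1 t3 \<omega> in auto)
  finally have "W\<^sup>2 * (m ^ 3 * W) \<le> W\<^sup>2 * (LINT x|M. \<omega> x * t x ^ 3)"
    by (intro mult_left_mono) auto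
  moreover have "W\<^sup>2 * (m ^ 3 * W) = (LINT x|M. \<omega> x * t x) ^ 3"
    using W by (simp add: m_def power_divide power2_eq_square power3_eq_cube)
  ultimately show ?thesis by (simp add: W_def)
qed

text \<open>
  Jensen's inequality for the power \<open>3/2\<close>, applied to \<open>t\<^sup>2\<close>. With \<open>m\<close> the root mean square, it
  comes from \<open>2t\<^sup>3 - 3mt\<^sup>2 + m\<^sup>3 = (t - m)\<^sup>2(2t + m) \<ge> 0\<close>.
\<close>
lemma root_mean_square_cubed_le_mean_cube:
  fixes \<omega> t :: "'a \<Rightarrow> real"
  assumes \<omega>: "integrable M \<omega>" "\<And>x. 0 \<le> \<omega> x" "(LINT x|M. \<omega> x) = 1"
    and t2: "integrable M (\<lambda>x. \<omega> x * (t x)\<^sup>2)" and t3: "integrable M (\<lambda>x. \<omega> x * t x ^ 3)"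
    and t: "\<And>x. 0 \<le> t x"
  shows "sqrt (LINT x|M. \<omega> x * (t x)\<^sup>2) ^ 3 \<le> (LINT x|M. \<omega> x * t x ^ 3)"
proof -
  define s where "s = (LINT x|M. \<omega> x * (t x)\<^sup>2)"
  have s: "0 \<le> s"
    unfolding s_def using \<omega> by (intro Bochner_Integration.integral_nonneg) auto
  define m where "m = sqrt s"
  have m: "0 \<le> m" "m\<^sup>2 = s" using s by (auto simp: m_def)
  have "m ^ 3 = (LINT x|M. 3 / 2 * m * (\<omega> x * (t x)\<^sup>2) - 1 / 2 * m ^ 3 * \<omega> x)"
  proof -
    have "(LINT x|M. 3 / 2 * m * (\<omega> x * (t x)\<^sup>2) - 1 / 2 * m ^ 3 * \<omega> x) = 3 / 2 * m * s - 1 / 2 * m ^ 3"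
      using t2 \<omega> by (simp add: s_def)
    then show ?thesis
      by (simp add: m(2)[symmetric] power2_eq_square power3_eq_cube)
  qed
  also have "\<dots> \<le> (LINT x|M. \<omega> x * t x ^ 3)"
  proof (rule integral_mono)
    fix x
    have "0 \<le> \<omega> x * ((t x - m)\<^sup>2 * (2 * t x + m))"
      using \<omega>(2)[of x] t[of x] m by (intro mult_nonneg_nonneg) auto
    then show "3 / 2 * m * (\<omega> x * (t x)\<^sup>2) - 1 / 2 * m ^ 3 * \<omega> x \<le> \<omega> x * t x ^ 3"
      by (simp add: power2_eq_square power3_eq_cube algebra_simps)
  qed (use t2 t3 \<omega> in auto)
  finally show ?thesis by (simp add: m_def s_def)
qed

context mollifier
begin

lemma k_cont: "continuous_on UNIV k"
  by (meson der differentiable_def differentiable_imp_continuous_on differentiable_on_def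
      has_derivative_at_withinI)

lemma k_measurable [measurable]: "k \<in> borel_measurable borel"
  by (rule borel_measurable_continuous_onI[OF k_cont])

lemma k_integrable: "integrable lborel k"
  by (rule integrable_continuous_bounded_support[OF k_cont bounded_ball[of 0 \<epsilon>]])
     (use k_support in auto)

lemma dk_nth_cont: "continuous_on UNIV (\<lambda>z. dk z $ j)"
  using dk_cont by (intro continuous_intros)

lemma dk_nth_integrable: "integrable lborel (\<lambda>z. dk z $ j)"
  by (rule integrable_continuous_bounded_support[OF dk_nth_cont bounded_ball[of 0 \<epsilon>]])
     (use dk_support in auto)

lemma dk_nth_integral: "(LINT z|lborel. dk z $ j) = 0"
  using integral_derivative_eq_0[OF der, of "axis j 1" "ball 0 \<epsilon>"] dk_nth_cont k_support
  by (auto simp: inner_axis)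

lemma dk_nth_le: "\<bar>dk z $ j\<bar> \<le> indicator (ball 0 \<epsilon>) z * (A / \<epsilon> ^ Suc CARD('n))"
  using dk_le[of z] component_le_norm_cart[of "dk z" j] dk_support[of z]
  by (auto simp: indicator_def)

lemma norm_mollify_le_1:
  fixes w :: "real ^ 'n \<Rightarrow> 'b::euclidean_space"
  assumes [measurable]: "w \<in> borel_measurable borel" and "\<And>y. norm (w y) \<le> 1"
  shows "norm (mollify k w x) \<le> 1"
  using mollify_norm_le[OF k_integrable assms, of x] k_nonneg k_integral by simp

end

text \<open>
  The first term comes from the Hessian: it has \<open>N\<^sup>2\<close> entries, each bounded by an integral over the ball,
  whose volume enters through Jensen's inequality. The second comes from \<open>1 - \<bar>\<nabla>\<psi>\<^sub>\<epsilon>\<bar>\<^sup>2\<close>.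
\<close>
definition recovery_constant :: "nat \<Rightarrow> real \<Rightarrow> real"
  where "recovery_constant N A = real N ^ 6 * A ^ 3 * (unit_ball_vol (real N))\<^sup>2 + A"

lemma recovery_constant_pos: "0 < A \<Longrightarrow> 0 < recovery_constant N A"
  unfolding recovery_constant_def by (intro add_nonneg_pos) auto

text \<open>
  A vector field \<open>w\<close> of unit length near a point \<open>x\<close>, with a vector \<open>a\<close> to which its values are
  compared; \<open>a\<close> is \<open>w x\<close> in the application.
\<close>
locale mollified_unit_field = mollifier A \<epsilon> k dk
  for A \<epsilon> :: real and k :: "real ^ 'n \<Rightarrow> real" and dk +
  fixes w :: "real ^ 'n \<Rightarrow> real ^ 'n" and x a :: "real ^ 'n"
  assumes w [measurable]: "w \<in> borel_measurable borel"
    and w_le: "\<And>y. norm (w y) \<le> 1"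
    and w_unit: "\<And>y. y \<in> ball x \<epsilon> \<Longrightarrow> norm (w y) = 1"
begin

definition osc where "osc = (LINT z|lborel. indicator (ball 0 \<epsilon>) z * norm (w (x + z) - a) ^ 3)"

lemma dev_le: "norm (w y - a) \<le> 1 + norm a"
  using norm_triangle_ineq4[of "w y" a] w_le[of y] by linarith

lemma dev_integrable:
  assumes "integrable lborel \<omega>"
  shows "integrable lborel (\<lambda>z. \<omega> z * norm (w (x + z) - a) ^ p)"
proof (rule Bochner_Integration.integrable_bound)
  have [measurable]: "\<omega> \<in> borel_measurable borel" using assms by auto
  show "integrable lborel (\<lambda>z. \<omega> z * (1 + norm a) ^ p)" using assms by simp
  show "(\<lambda>z. \<omega> z * norm (w (x + z) - a) ^ p) \<in> borel_measurable lborel" by measurable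
  show "AE z in lborel. norm (\<omega> z * norm (w (x + z) - a) ^ p) \<le> norm (\<omega> z * (1 + norm a) ^ p)"
    using dev_le by (intro AE_I2) (auto simp: abs_mult power_abs intro!: mult_left_mono power_mono)
qed

lemma indicator_ball_integrable: "integrable lborel (indicator (ball (0::real^'n) \<epsilon>) :: _ \<Rightarrow> real)"
  by (intro integrable_real_indicator emeasure_bounded_finite) auto

text \<open>
  With \<open>G\<close> the mollified field, the weighted mean square of \<open>w - a\<close> equals
  \<open>1 - \<bar>G\<bar>\<^sup>2 + \<bar>a - G\<bar>\<^sup>2\<close>, by expanding the square and \<open>\<bar>w\<bar> = 1\<close>.
\<close>
lemma deficit_le:
  "\<bar>1 - (norm (mollify k w x))\<^sup>2\<bar> powr (3 / 2) \<le> A / \<epsilon> ^ CARD('n) * osc"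
proof -
  define G where "G = mollify k w x"
  define s where "s = (LINT z|lborel. k z * norm (w (x + z) - a) ^ 2)"
  have G1: "norm G \<le> 1" unfolding G_def by (rule norm_mollify_le_1[OF w w_le])
  have int: "integrable lborel (\<lambda>z. k z *\<^sub>R w (x + z))"
    by (rule mollify_integrable[OF k_integrable w w_le])
  have "k z * norm (w (x + z) - a) ^ 2 = (1 + (norm a)\<^sup>2) * k z - 2 * (a \<bullet> (k z *\<^sub>R w (x + z)))" for z
  proof (cases "norm z < \<epsilon>")
    case True
    then have "norm (w (x + z)) = 1" by (intro w_unit) (simp add: dist_norm)
    then have "norm (w (x + z) - a) ^ 2 = 1 + (norm a)\<^sup>2 - 2 * (a \<bullet> w (x + z))"
      by (simp add: power2_norm_eq_inner inner_diff_left inner_diff_right inner_commute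
          norm_eq_1)
    then show ?thesis by (simp only:) (simp add: algebra_simps)
  qed (use k_support in auto)
  then have "s = (1 + (norm a)\<^sup>2) * (LINT z|lborel. k z) - 2 * (LINT z|lborel. a \<bullet> (k z *\<^sub>R w (x + z)))"
    unfolding s_def using int k_integrable by (simp del: inner_scaleR_right)
  also have "\<dots> = (1 + (norm a)\<^sup>2) - 2 * (a \<bullet> G)"
    unfolding G_def mollify_def using int by (simp add: k_integral del: inner_scaleR_right)
  also have "\<dots> = 1 - (norm G)\<^sup>2 + (norm (a - G))\<^sup>2"
    by (simp add: power2_norm_eq_inner inner_diff_left inner_diff_right inner_commute)
  finally have s: "1 - (norm G)\<^sup>2 \<le> s" by simp
  have G2: "0 \<le> 1 - (norm G)\<^sup>2" using G1 by (simp add: power_le_one)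
  have "\<bar>1 - (norm G)\<^sup>2\<bar> powr (3 / 2) \<le> s powr (3 / 2)"
    using s G2 by (intro powr_mono2) auto
  also have "\<dots> = sqrt s ^ 3"
  proof (cases "s = 0")
    case False
    then have "s > 0" using s G2 by linarith
    then show ?thesis by (simp add: powr_half_sqrt[symmetric] powr_powr flip: powr_numeral)
  qed simp
  also have "\<dots> \<le> (LINT z|lborel. k z * norm (w (x + z) - a) ^ 3)"
    unfolding s_def
    by (rule root_mean_square_cubed_le_mean_cube)
       (auto intro: k_integrable k_nonneg k_integral dev_integrable)
  also have "\<dots> \<le> (LINT z|lborel. A / \<epsilon> ^ CARD('n) * (indicator (ball 0 \<epsilon>) z * norm (w (x + z) - a) ^ 3))"
  proof (rule integral_mono)
    show "k z * norm (w (x + z) - a) ^ 3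
        \<le> A / \<epsilon> ^ CARD('n) * (indicator (ball 0 \<epsilon>) z * norm (w (x + z) - a) ^ 3)" for z
      using mult_right_mono[OF k_le[of z], of "norm (w (x + z) - a) ^ 3"] k_support[of z]
      by (auto simp: indicator_def)
  qed (intro integrable_mult_right dev_integrable k_integrable indicator_ball_integrable)+
  finally show ?thesis by (simp add: osc_def G_def)
qed

text \<open>
  As \<open>dk\<close> has integral zero, \<open>w\<close> can be replaced by \<open>w - a\<close>. The factor \<open>1 / \<epsilon>\<^sup>3\<^sup>N\<^sup>+\<^sup>3\<close> from the cube of
  the bound on \<open>dk\<close> is reduced by the squared volume \<open>\<epsilon>\<^sup>2\<^sup>N\<close> in Jensen's inequality.
\<close>
lemma mollify_dk_le:
  "\<bar>mollify (\<lambda>z. dk z $ j) (\<lambda>y. w y $ i) x\<bar> ^ 3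
    \<le> A ^ 3 * (unit_ball_vol (real CARD('n)))\<^sup>2 * osc / \<epsilon> ^ (CARD('n) + 3)"
proof -
  let ?N = "CARD('n)"
  define J where "J = (LINT z|lborel. indicator (ball 0 \<epsilon>) z * norm (w (x + z) - a))"
  have wi: "(\<lambda>y. w y $ i) \<in> borel_measurable borel"
    by (rule borel_measurable_nth[OF w])
  have wi_le: "norm (w y $ i) \<le> 1" for y
    using component_le_norm_cart[of "w y" i] w_le[of y] by simp
  have int: "integrable lborel (\<lambda>z. dk z $ j *\<^sub>R w (x + z) $ i)"
    using mollify_integrable[OF dk_nth_integrable wi wi_le] by simp
  have "mollify (\<lambda>z. dk z $ j) (\<lambda>y. w y $ i) x
      = (LINT z|lborel. dk z $ j *\<^sub>R w (x + z) $ i - dk z $ j * a $ i)"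
    unfolding mollify_def using int dk_nth_integrable by (simp add: dk_nth_integral)
  also have "\<bar>\<dots>\<bar> \<le> (LINT z|lborel. norm (dk z $ j *\<^sub>R w (x + z) $ i - dk z $ j * a $ i))"
    unfolding real_norm_def[symmetric] by (rule integral_norm_bound)
  also have "\<dots> \<le> (LINT z|lborel. A / \<epsilon> ^ Suc ?N * (indicator (ball 0 \<epsilon>) z * norm (w (x + z) - a)))"
  proof (rule integral_mono)
    show "integrable lborel (\<lambda>z. norm (dk z $ j *\<^sub>R w (x + z) $ i - dk z $ j * a $ i))"
      using int dk_nth_integrable by auto
    show "integrable lborel (\<lambda>z. A / \<epsilon> ^ Suc ?N * (indicator (ball 0 \<epsilon>) z * norm (w (x + z) - a)))"
      using dev_integrable[OF indicator_ball_integrable, of 1] by simp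
    fix z
    have "norm (dk z $ j *\<^sub>R w (x + z) $ i - dk z $ j * a $ i)
        = \<bar>dk z $ j\<bar> * \<bar>(w (x + z) - a) $ i\<bar>"
      by (simp add: abs_mult flip: right_diff_distrib)
    also have "\<dots> \<le> (indicator (ball 0 \<epsilon>) z * (A / \<epsilon> ^ Suc ?N)) * norm (w (x + z) - a)"
      using A_pos eps_pos by (intro mult_mono dk_nth_le component_le_norm_cart) auto
    finally show "norm (dk z $ j *\<^sub>R w (x + z) $ i - dk z $ j * a $ i)
        \<le> A / \<epsilon> ^ Suc ?N * (indicator (ball 0 \<epsilon>) z * norm (w (x + z) - a))"
      by (simp add: mult_ac)
  qed
  also have "\<dots> = A / \<epsilon> ^ Suc ?N * J" by (simp add: J_def)
  finally have 1: "\<bar>mollify (\<lambda>z. dk z $ j) (\<lambda>y. w y $ i) x\<bar> ^ 3 \<le> (A / \<epsilon> ^ Suc ?N * J) ^ 3"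
    by (intro power_mono) auto
  have "measure lborel (ball (0::real^'n) \<epsilon>) = unit_ball_vol (real ?N) * \<epsilon> ^ ?N"
    using eps_pos by (simp add: content_ball)
  then have vol: "(LINT z|lborel. indicator (ball (0::real^'n) \<epsilon>) z) = unit_ball_vol (real ?N) * \<epsilon> ^ ?N"
    by simp
  have "J ^ 3 \<le> (unit_ball_vol (real ?N) * \<epsilon> ^ ?N)\<^sup>2 * osc"
    unfolding J_def osc_def vol[symmetric]
    using dev_integrable[OF indicator_ball_integrable, of 1]
      dev_integrable[OF indicator_ball_integrable, of 3]
    by (intro cube_mean_le_mean_cube indicator_ball_integrable) auto
  then have "(A / \<epsilon> ^ Suc ?N) ^ 3 * J ^ 3
      \<le> (A / \<epsilon> ^ Suc ?N) ^ 3 * ((unit_ball_vol (real ?N) * \<epsilon> ^ ?N)\<^sup>2 * osc)"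
    using A_pos eps_pos by (intro mult_left_mono) auto
  also have "\<dots> = A ^ 3 * (unit_ball_vol (real ?N))\<^sup>2 * osc / \<epsilon> ^ (?N + 3)"
    using eps_pos by (simp add: power_divide power_mult_distrib field_simps power_add power2_eq_square power3_eq_cube)
  finally show ?thesis using 1 by (simp only: power_mult_distrib)
qed

lemma osc_nonneg: "0 \<le> osc"
  unfolding osc_def by (intro Bochner_Integration.integral_nonneg) auto

lemma norm_hessian_le:
  "norm (\<chi> i j. - mollify (\<lambda>z. dk z $ j) (\<lambda>y. w y $ i) x) ^ 3
    \<le> real CARD('n) ^ 6 * (A ^ 3 * (unit_ball_vol (real CARD('n)))\<^sup>2 * osc / \<epsilon> ^ (CARD('n) + 3))"
proof -
  let ?H = "\<chi> i j. - mollify (\<lambda>z. dk z $ j) (\<lambda>y. w y $ i) x"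
  define T where "T = A ^ 3 * (unit_ball_vol (real CARD('n)))\<^sup>2 * osc / \<epsilon> ^ (CARD('n) + 3)"
  have T: "0 \<le> T"
    unfolding T_def using A_pos eps_pos osc_nonneg by simp
  have entry: "\<bar>?H $ i $ j\<bar> \<le> root 3 T" for i j
  proof -
    have "\<bar>?H $ i $ j\<bar> = root 3 (\<bar>?H $ i $ j\<bar> ^ 3)" by (simp add: real_root_power_cancel)
    also have "\<dots> \<le> root 3 T" using mollify_dk_le[of j i] by (simp add: T_def)
    finally show ?thesis .
  qed
  have "norm ?H \<le> (\<Sum>i\<in>UNIV. norm (?H $ i))"
    unfolding norm_vec_def[of ?H] by (intro L2_set_le_sum) auto
  also have "\<dots> \<le> (\<Sum>i\<in>(UNIV::'n set). \<Sum>j\<in>(UNIV::'n set). root 3 T)"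
    by (intro sum_mono order_trans[OF norm_le_l1_cart] entry)
  also have "\<dots> = real CARD('n) ^ 2 * root 3 T" by (simp add: power2_eq_square)
  finally have "norm ?H ^ 3 \<le> (real CARD('n) ^ 2 * root 3 T) ^ 3"
    by (intro power_mono) auto
  also have "\<dots> = real CARD('n) ^ 6 * T"
    using T by (simp add: power_mult_distrib)
  finally show ?thesis by (simp add: T_def)
qed

lemma energy_density_le:
  "\<epsilon>\<^sup>2 * norm (\<chi> i j. - mollify (\<lambda>z. dk z $ j) (\<lambda>y. w y $ i) x) ^ 3
      + 1 / \<epsilon> * \<bar>1 - (norm (mollify k w x))\<^sup>2\<bar> powr (3 / 2)
    \<le> recovery_constant CARD('n) A * (osc / \<epsilon> ^ Suc CARD('n))"
proof -
  have "\<epsilon>\<^sup>2 * norm (\<chi> i j. - mollify (\<lambda>z. dk z $ j) (\<lambda>y. w y $ i) x) ^ 3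
      \<le> \<epsilon>\<^sup>2 * (real CARD('n) ^ 6 * (A ^ 3 * (unit_ball_vol (real CARD('n)))\<^sup>2 * osc / \<epsilon> ^ (CARD('n) + 3)))"
    by (intro mult_left_mono norm_hessian_le) auto
  also have "\<dots> = real CARD('n) ^ 6 * A ^ 3 * (unit_ball_vol (real CARD('n)))\<^sup>2 * (osc / \<epsilon> ^ Suc CARD('n))"
    using eps_pos by (simp add: power_add power2_eq_square power3_eq_cube mult_ac)
  finally have H: "\<epsilon>\<^sup>2 * norm (\<chi> i j. - mollify (\<lambda>z. dk z $ j) (\<lambda>y. w y $ i) x) ^ 3 \<le> \<dots>" .
  have "1 / \<epsilon> * \<bar>1 - (norm (mollify k w x))\<^sup>2\<bar> powr (3 / 2) \<le> 1 / \<epsilon> * (A / \<epsilon> ^ CARD('n) * osc)"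
    using eps_pos by (intro mult_left_mono deficit_le) auto
  also have "\<dots> = A * (osc / \<epsilon> ^ Suc CARD('n))" by simp
  finally show ?thesis
    unfolding recovery_constant_def using H by (simp only: distrib_right add_mono)
qed

text \<open>
  On the ball, \<open>1/\<epsilon> \<le> 1/\<bar>y - x\<bar>\<close>. At \<open>y = x\<close> both integrands vanish, because division by zero
  gives zero.
\<close>
lemma osc_le_nn_integral:
  assumes a: "a = w x"
  shows "ennreal (osc / \<epsilon> ^ Suc CARD('n)) \<le> (\<integral>\<^sup>+y\<in>ball x \<epsilon>.
    ennreal (1 / \<epsilon> ^ CARD('n) * (norm (w y - w x) ^ 3 / norm (y - x))) \<partial>lborel)"
proof -
  define F where "F y = ennreal (1 / \<epsilon> ^ CARD('n) * (norm (w y - w x) ^ 3 / norm (y - x)))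
    * indicator (ball x \<epsilon>) y" for y
  have [measurable]: "ball x \<epsilon> \<in> sets borel" by simp
  have F [measurable]: "F \<in> borel_measurable borel"
    unfolding F_def by measurable
  have "ennreal (osc / \<epsilon> ^ Suc CARD('n))
      = ennreal (LINT z|lborel. indicator (ball 0 \<epsilon>) z * norm (w (x + z) - a) ^ 3 / \<epsilon> ^ Suc CARD('n))"
    by (simp add: osc_def)
  also have "\<dots> = (\<integral>\<^sup>+z. ennreal (indicator (ball 0 \<epsilon>) z * norm (w (x + z) - a) ^ 3 / \<epsilon> ^ Suc CARD('n)) \<partial>lborel)"
    using eps_pos dev_integrable[OF indicator_ball_integrable, of 3]
    by (intro nn_integral_eq_integral[symmetric] integrable_divide) auto
  also have "\<dots> \<le> (\<integral>\<^sup>+z. F (x + z) \<partial>lborel)"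
  proof (intro nn_integral_mono)
    fix z :: "real ^ 'n"
    show "ennreal (indicator (ball 0 \<epsilon>) z * norm (w (x + z) - a) ^ 3 / \<epsilon> ^ Suc CARD('n)) \<le> F (x + z)"
    proof (cases "0 < norm z \<and> norm z < \<epsilon>")
      case True
      then have "norm (w (x + z) - w x) ^ 3 / (\<epsilon> * \<epsilon> ^ CARD('n))
          \<le> norm (w (x + z) - w x) ^ 3 / (norm z * \<epsilon> ^ CARD('n))"
        using eps_pos by (intro divide_left_mono mult_right_mono mult_pos_pos) auto
      then show ?thesis
        using True by (simp add: F_def a dist_norm mult.commute ennreal_leI)
    qed (auto simp: a indicator_def)
  qed
  also have "\<dots> = (\<integral>\<^sup>+y. F y \<partial>lborel)" by (rule nn_integral_lborel_translate[OF F])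
  finally show ?thesis by (simp add: F_def)
qed

end

section \<open>Strong convergence of mollifications\<close>

text \<open>
  A measurable function is almost everywhere the limit of continuous ones. Clamping these to the
  ball of radius \<open>M\<close> keeps them continuous and makes dominated convergence applicable.
\<close>
lemma continuous_L1_approximation:
  fixes w :: "'a::euclidean_space \<Rightarrow> 'b::euclidean_space"
  assumes w [measurable]: "w \<in> borel_measurable borel" and M: "\<And>x. norm (w x) \<le> M"
    and K: "compact K" and e: "0 < e"
  obtains h where "continuous_on UNIV h" "(\<integral>\<^sup>+x\<in>K. ennreal (norm (w x - h x)) \<partial>lborel) < ennreal e"
proof -
  have M0: "0 \<le> M" using M norm_ge_zero order_trans by blast
  have Kb [measurable]: "K \<in> sets borel" using K by (simp add: compact_imp_closed)
  have "w measurable_on UNIV"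
    by (subst measurable_on_iff_borel_measurable) (auto simp: lebesgue_on_UNIV_eq intro: measurable_completion)
  then obtain Z g where Z: "negligible Z" and g: "\<And>n::nat. continuous_on UNIV (g n)"
    and lim: "\<And>x. x \<notin> Z \<Longrightarrow> (\<lambda>n. g n x) \<longlonglongrightarrow> w x"
    unfolding measurable_on_def by auto
  define c where "c = closest_point (cball (0::'b) M)"
  have c_cont: "continuous_on UNIV c"
    unfolding c_def using M0 by (intro continuous_on_closest_point) auto
  have c_le: "norm (c v) \<le> M" for v
    using closest_point_in_set[of "cball (0::'b) M" v] M0 by (simp add: c_def)
  have c_w: "c (w x) = w x" for x
    unfolding c_def using M[of x] by (intro closest_point_self) simp
  define h where "h n x = c (g n x)" for n x
  have h_cont: "continuous_on UNIV (h n)" for n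
    unfolding h_def by (rule continuous_on_compose2[OF c_cont g]) auto
  have [measurable]: "h n \<in> borel_measurable borel" for n
    by (rule borel_measurable_continuous_onI[OF h_cont])
  have "(\<lambda>n. \<integral>\<^sup>+x. norm (indicator K x *\<^sub>R w x - indicator K x *\<^sub>R h n x) \<partial>lborel) \<longlonglongrightarrow> 0"
  proof (rule nn_integral_dominated_convergence_norm[where w="\<lambda>x. indicator K x * M"])
    show "AE x in lborel. norm (indicator K x *\<^sub>R h j x) \<le> indicator K x * M" for j
      by (auto simp: h_def c_le indicator_def)
    have "(\<integral>\<^sup>+x. ennreal (indicator K x * M) \<partial>lborel) = ennreal M * emeasure lborel K"
      using M0 by (subst nn_integral_cmult_indicator[symmetric])
        (auto intro!: nn_integral_cong simp: indicator_def)
    then show "(\<integral>\<^sup>+x. ennreal (indicator K x * M) \<partial>lborel) < \<infinity>"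
      using emeasure_bounded_finite[OF compact_imp_bounded[OF K]]
      by (simp add: ennreal_mult_less_top)
    have "AE x in lebesgue. x \<notin> Z"
      using Z by (intro AE_not_in) (simp add: negligible_iff_null_sets)
    then have "AE x in lborel. x \<notin> Z" by (simp only: AE_completion_iff)
    then show "AE x in lborel. (\<lambda>n. indicator K x *\<^sub>R h n x) \<longlonglongrightarrow> indicator K x *\<^sub>R w x"
    proof eventually_elim
      case (elim x)
      have "(\<lambda>n. c (g n x)) \<longlonglongrightarrow> c (w x)"
        using continuous_on_tendsto_compose[OF c_cont lim[OF elim]] by simp
      then show ?case by (intro tendsto_intros) (simp add: h_def c_w)
    qed
  qed measurable
  then have "\<forall>\<^sub>F n in sequentially.
      (\<integral>\<^sup>+x. norm (indicator K x *\<^sub>R w x - indicator K x *\<^sub>R h n x) \<partial>lborel) < ennreal e"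
    using e by (intro order_tendstoD(2)[of _ 0]) auto
  then obtain n where "(\<integral>\<^sup>+x. norm (indicator K x *\<^sub>R w x - indicator K x *\<^sub>R h n x) \<partial>lborel) < ennreal e"
    by (auto simp: eventually_sequentially)
  moreover have "(\<integral>\<^sup>+x. norm (indicator K x *\<^sub>R w x - indicator K x *\<^sub>R h n x) \<partial>lborel)
      = (\<integral>\<^sup>+x\<in>K. ennreal (norm (w x - h n x)) \<partial>lborel)"
    by (intro nn_integral_cong) (auto simp: indicator_def)
  ultimately show ?thesis using that h_cont by metis
qed

text \<open>
  For a continuous function in place of \<open>w\<close>, this is uniform continuity on a compact set. The general case
  follows by approximation in \<open>L\<^sup>1\<close> on a ball of radius \<open>R + 1\<close>, which contains the translates of
  the ball of radius \<open>R\<close> by vectors shorter than \<open>1\<close>.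
\<close>
lemma L1_translation_continuous:
  fixes w :: "'a::euclidean_space \<Rightarrow> 'b::euclidean_space"
  assumes w [measurable]: "w \<in> borel_measurable borel" and M: "\<And>x. norm (w x) \<le> M"
    and e: "0 < e"
  obtains d where "0 < d" "\<And>z. norm z < d \<Longrightarrow>
    (\<integral>\<^sup>+x\<in>cball 0 R. ennreal (norm (w (x + z) - w x)) \<partial>lborel) \<le> ennreal e"
proof -
  define K where "K = cball (0::'a) (R + 1)"
  have K: "compact K" by (simp add: K_def)
  have [measurable]: "cball (0::'a) R \<in> sets borel" "K \<in> sets borel" by (auto simp: K_def)
  define V where "V = measure lborel (cball (0::'a) R)"
  obtain h where h: "continuous_on UNIV h"
    and wh: "(\<integral>\<^sup>+x\<in>K. ennreal (norm (w x - h x)) \<partial>lborel) < ennreal (e / 3)"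
    using continuous_L1_approximation[OF w M K, of "e / 3"] e by auto
  have [measurable]: "h \<in> borel_measurable borel" by (rule borel_measurable_continuous_onI[OF h])
  have "uniformly_continuous_on K h"
    by (intro compact_uniformly_continuous continuous_on_subset[OF h] K) auto
  moreover have "0 < e / (3 * (V + 1))" using e by (simp add: V_def add_nonneg_pos)
  ultimately obtain d where d: "0 < d"
    "\<And>x y. x \<in> K \<Longrightarrow> y \<in> K \<Longrightarrow> dist y x < d \<Longrightarrow> dist (h y) (h x) < e / (3 * (V + 1))"
    unfolding uniformly_continuous_on_def by metis
  have add3: "(\<integral>\<^sup>+x. f1 x + (f2 x + f3 x) \<partial>lborel)
      = (\<integral>\<^sup>+x. f1 x \<partial>lborel) + ((\<integral>\<^sup>+x. f2 x \<partial>lborel) + (\<integral>\<^sup>+x. f3 x \<partial>lborel))"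
    if "f1 \<in> borel_measurable lborel" "f2 \<in> borel_measurable lborel" "f3 \<in> borel_measurable lborel"
    for f1 f2 f3 :: "'a \<Rightarrow> ennreal"
    using that by (simp add: nn_integral_add)
  show ?thesis
  proof (rule that[of "min 1 d"])
    show "0 < min 1 d" using d by simp
    fix z :: 'a assume z: "norm z < min 1 d"
    have inK: "x + z \<in> K" "x \<in> K" if "x \<in> cball 0 R" for x
      using that z norm_triangle_ineq[of x z] by (auto simp: K_def)
    have "(\<integral>\<^sup>+x\<in>cball 0 R. ennreal (norm (w (x + z) - w x)) \<partial>lborel)
      \<le> (\<integral>\<^sup>+x. ennreal (norm (w (z + x) - h (z + x))) * indicator K (z + x)
          + (ennreal (e / (3 * (V + 1))) * indicator (cball 0 R) x
          + ennreal (norm (w x - h x)) * indicator K x) \<partial>lborel)"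
    proof (intro nn_integral_mono)
      fix x :: 'a
      show "ennreal (norm (w (x + z) - w x)) * indicator (cball 0 R) x
        \<le> ennreal (norm (w (z + x) - h (z + x))) * indicator K (z + x)
          + (ennreal (e / (3 * (V + 1))) * indicator (cball 0 R) x
          + ennreal (norm (w x - h x)) * indicator K x)"
      proof (cases "x \<in> cball 0 R")
        case True
        have "norm (w (x + z) - w x)
            \<le> norm (w (x + z) - h (x + z)) + (norm (h (x + z) - h x) + norm (w x - h x))"
          using norm_triangle_ineq[of "w (x + z) - h (x + z)" "(h (x + z) - h x) + (h x - w x)"]
            norm_triangle_ineq[of "h (x + z) - h x" "h x - w x"] norm_minus_commute[of "h x" "w x"]
          by simp
        also have "norm (h (x + z) - h x) \<le> e / (3 * (V + 1))"
          using d(2)[OF inK(2)[OF True] inK(1)[OF True]] z by (simp add: dist_norm)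
        finally have "ennreal (norm (w (x + z) - w x))
            \<le> ennreal (norm (w (x + z) - h (x + z)) + (e / (3 * (V + 1)) + norm (w x - h x)))"
          by (intro ennreal_leI) simp
        also have "\<dots> = ennreal (norm (w (x + z) - h (x + z)))
            + (ennreal (e / (3 * (V + 1))) + ennreal (norm (w x - h x)))"
          using e by (simp add: V_def)
        finally show ?thesis using inK[OF True] True by (simp add: add.commute)
      qed simp
    qed
    also have "\<dots> = (\<integral>\<^sup>+x. ennreal (norm (w (z + x) - h (z + x))) * indicator K (z + x) \<partial>lborel)
        + ((\<integral>\<^sup>+x. ennreal (e / (3 * (V + 1))) * indicator (cball (0::'a) R) x \<partial>lborel)
        + (\<integral>\<^sup>+x. ennreal (norm (w x - h x)) * indicator K x \<partial>lborel))"
      by (rule add3) measurable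
    also have "(\<integral>\<^sup>+x. ennreal (norm (w (z + x) - h (z + x))) * indicator K (z + x) \<partial>lborel)
        = (\<integral>\<^sup>+x\<in>K. ennreal (norm (w x - h x)) \<partial>lborel)"
      by (rule nn_integral_lborel_translate) measurable
    also have "(\<integral>\<^sup>+x. ennreal (e / (3 * (V + 1))) * indicator (cball (0::'a) R) x \<partial>lborel)
        = ennreal (e / (3 * (V + 1)) * V)"
    proof -
      have "emeasure lborel (cball (0::'a) R) = ennreal V"
        using emeasure_bounded_finite[OF bounded_cball, of "0::'a" R]
        by (simp add: V_def emeasure_eq_ennreal_measure less_top[symmetric])
      moreover have "0 \<le> V" by (simp add: V_def)
      ultimately show ?thesis
        using e by (simp add: nn_integral_cmult_indicator flip: ennreal_mult)
    qed
    also have "(\<integral>\<^sup>+x\<in>K. ennreal (norm (w x - h x)) \<partial>lborel)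
        + (ennreal (e / (3 * (V + 1)) * V) + (\<integral>\<^sup>+x\<in>K. ennreal (norm (w x - h x)) \<partial>lborel))
        \<le> ennreal (e / 3) + (ennreal (e / 3) + ennreal (e / 3))"
    proof (intro add_mono less_imp_le[OF wh] ennreal_leI)
      show "e / (3 * (V + 1)) * V \<le> e / 3"
        using e by (simp add: V_def divide_simps add_nonneg_pos)
    qed
    also have "\<dots> = ennreal e" using e by (simp flip: ennreal_plus)
    finally show "(\<integral>\<^sup>+x\<in>cball 0 R. ennreal (norm (w (x + z) - w x)) \<partial>lborel) \<le> ennreal e" .
  qed
qed

text \<open>
  \<open>mollify k w - w\<close> is an average, with weight \<open>k\<close>, of the differences between the translates of \<open>w\<close>
  and \<open>w\<close> itself; so its \<open>L\<^sup>1\<close> norm is at most the largest of the norms of these differences.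
\<close>
lemma (in mollifier) mollify_L1_le:
  fixes w :: "real ^ 'n \<Rightarrow> 'b::euclidean_space"
  assumes w [measurable]: "w \<in> borel_measurable borel" and M: "\<And>x. norm (w x) \<le> M"
    and S [measurable]: "S \<in> sets borel"
    and le: "\<And>z. norm z < \<epsilon> \<Longrightarrow> (\<integral>\<^sup>+x\<in>S. ennreal (norm (w (x + z) - w x)) \<partial>lborel) \<le> ennreal e"
  shows "(\<integral>\<^sup>+x\<in>S. ennreal (norm (mollify k w x - w x)) \<partial>lborel) \<le> ennreal e"
proof -
  have "ennreal (norm (mollify k w x - w x)) \<le> (\<integral>\<^sup>+z. ennreal (k z) * ennreal (norm (w (x + z) - w x)) \<partial>lborel)" for x
  proof -
    have int: "integrable lborel (\<lambda>z. k z *\<^sub>R w (x + z))"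
      by (rule mollify_integrable[OF k_integrable w M])
    have int': "integrable lborel (\<lambda>z. k z *\<^sub>R (w (x + z) - w x))"
      using int k_integrable by (simp add: scaleR_diff_right)
    have "mollify k w x - w x = (LINT z|lborel. k z *\<^sub>R (w (x + z) - w x))"
      unfolding mollify_def using int k_integrable by (simp add: scaleR_diff_right k_integral)
    also have "ennreal (norm \<dots>) \<le> (\<integral>\<^sup>+z. norm (k z *\<^sub>R (w (x + z) - w x)) \<partial>lborel)"
      by (rule integral_norm_bound_ennreal[OF int'])
    finally show ?thesis by (simp add: k_nonneg ennreal_mult)
  qed
  then have "(\<integral>\<^sup>+x\<in>S. ennreal (norm (mollify k w x - w x)) \<partial>lborel)
      \<le> (\<integral>\<^sup>+x. (\<integral>\<^sup>+z. ennreal (k z) * ennreal (norm (w (x + z) - w x)) \<partial>lborel) * indicator S x \<partial>lborel)"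
    by (intro nn_integral_mono mult_right_mono) auto
  also have "\<dots> = (\<integral>\<^sup>+x. (\<integral>\<^sup>+z. ennreal (k z) * (ennreal (norm (w (x + z) - w x)) * indicator S x) \<partial>lborel) \<partial>lborel)"
    by (subst nn_integral_multc[symmetric]) (auto simp: mult.assoc)
  also have "\<dots> = (\<integral>\<^sup>+z. (\<integral>\<^sup>+x. ennreal (k z) * (ennreal (norm (w (x + z) - w x)) * indicator S x) \<partial>lborel) \<partial>lborel)"
    by (rule lborel_pair.Fubini') measurable
  also have "\<dots> = (\<integral>\<^sup>+z. ennreal (k z) * (\<integral>\<^sup>+x\<in>S. ennreal (norm (w (x + z) - w x)) \<partial>lborel) \<partial>lborel)"
    by (intro nn_integral_cong nn_integral_cmult) measurable
  also have "\<dots> \<le> (\<integral>\<^sup>+z. ennreal (k z) * ennreal e \<partial>lborel)"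
  proof (intro nn_integral_mono)
    show "ennreal (k z) * (\<integral>\<^sup>+x\<in>S. ennreal (norm (w (x + z) - w x)) \<partial>lborel) \<le> ennreal (k z) * ennreal e" for z
      using le[of z] k_support[of z] by (cases "norm z < \<epsilon>") (auto intro: mult_left_mono)
  qed
  also have "\<dots> = (\<integral>\<^sup>+z. ennreal (k z) \<partial>lborel) * ennreal e"
    by (rule nn_integral_multc) measurable
  also have "(\<integral>\<^sup>+z. ennreal (k z) \<partial>lborel) = 1"
    using nn_integral_eq_integral[OF k_integrable] k_nonneg k_integral by simp
  finally show ?thesis by simp
qed

lemma mollify_tendsto_L1:
  fixes w :: "real ^ 'n \<Rightarrow> 'b::euclidean_space"
  assumes k: "\<And>\<epsilon>. 0 < \<epsilon> \<Longrightarrow> mollifier A \<epsilon> (k \<epsilon>) (dk \<epsilon>)"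
    and w: "w \<in> borel_measurable borel" and M: "\<And>x. norm (w x) \<le> M" and S: "bounded S"
  shows "((\<lambda>\<epsilon>. \<integral>\<^sup>+x\<in>S. ennreal (norm (mollify (k \<epsilon>) w x - w x)) \<partial>lborel) \<longlongrightarrow> 0) (at_right 0)"
proof (rule order_tendstoI)
  obtain R where R: "S \<subseteq> cball 0 R"
    using S bounded_subset_ballD by (metis ball_subset_cball subset_trans)
  fix e :: ennreal assume e: "0 < e"
  obtain e' :: real where e': "0 < e'" "ennreal e' < e"
  proof -
    obtain y where y: "0 < y" "y < e" using dense[OF e] by blast
    then have "y < top" using order.strict_trans2[OF y(2), of top] by simp
    then have "ennreal (enn2real y) = y" by simp
    then show ?thesis using y that[of "enn2real y"] by (simp add: enn2real_positive_iff \<open>y < top\<close>)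
  qed
  obtain d where d: "0 < d" "\<And>z. norm z < d \<Longrightarrow>
    (\<integral>\<^sup>+x\<in>cball 0 R. ennreal (norm (w (x + z) - w x)) \<partial>lborel) \<le> ennreal e'"
    using L1_translation_continuous[OF w M e'(1), of R] by blast
  have "(\<integral>\<^sup>+x\<in>S. ennreal (norm (mollify (k \<epsilon>) w x - w x)) \<partial>lborel) < e" if "0 < \<epsilon>" "\<epsilon> < d" for \<epsilon>
  proof -
    interpret mollifier A \<epsilon> "k \<epsilon>" "dk \<epsilon>" by (rule k[OF that(1)])
    have "(\<integral>\<^sup>+x\<in>S. ennreal (norm (mollify (k \<epsilon>) w x - w x)) \<partial>lborel)
        \<le> (\<integral>\<^sup>+x\<in>cball 0 R. ennreal (norm (mollify (k \<epsilon>) w x - w x)) \<partial>lborel)"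
      using R by (intro nn_integral_mono mult_left_mono) (auto simp: indicator_def)
    also have "\<dots> \<le> ennreal e'"
      using d that by (intro mollify_L1_le[OF w M]) auto
    finally show ?thesis using e' by simp
  qed
  then show "\<forall>\<^sub>F \<epsilon> in at_right 0. (\<integral>\<^sup>+x\<in>S. ennreal (norm (mollify (k \<epsilon>) w x - w x)) \<partial>lborel) < e"
    using d(1) by (auto simp: eventually_at_right_field)
qed simp

text \<open>
  The difference is at most \<open>2M\<close>, so its power \<open>q\<close> is at most \<open>(2M)\<^sup>q\<^sup>-\<^sup>1\<close> times its norm.
\<close>
lemma mollify_tendsto_Lp:
  fixes w :: "real ^ 'n \<Rightarrow> 'b::euclidean_space"
  assumes k: "\<And>\<epsilon>. 0 < \<epsilon> \<Longrightarrow> mollifier A \<epsilon> (k \<epsilon>) (dk \<epsilon>)"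
    and w [measurable]: "w \<in> borel_measurable borel" and M: "\<And>x. norm (w x) \<le> M" and S: "bounded S"
    and Sb [measurable]: "S \<in> sets borel"
    and q: "1 \<le> q"
  shows "((\<lambda>\<epsilon>. \<integral>\<^sup>+x\<in>S. ennreal (norm (mollify (k \<epsilon>) w x - w x) powr q) \<partial>lborel) \<longlongrightarrow> 0) (at_right 0)"
proof -
  define c where "c = ennreal ((2 * M) powr (q - 1))"
  have bound: "(\<integral>\<^sup>+x\<in>S. ennreal (norm (mollify (k \<epsilon>) w x - w x) powr q) \<partial>lborel)
      \<le> c * (\<integral>\<^sup>+x\<in>S. ennreal (norm (mollify (k \<epsilon>) w x - w x)) \<partial>lborel)" if "0 < \<epsilon>" for \<epsilon>
  proof -
    interpret mollifier A \<epsilon> "k \<epsilon>" "dk \<epsilon>" by (rule k[OF that])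
    note [measurable] = mollify_measurable[OF k_measurable w]
    have "norm (mollify (k \<epsilon>) w x) \<le> M" for x
      using mollify_norm_le[OF k_integrable w M, of x] k_nonneg k_integral by simp
    then have le: "norm (mollify (k \<epsilon>) w x - w x) \<le> 2 * M" for x
      using norm_triangle_ineq4[of "mollify (k \<epsilon>) w x" "w x"] M[of x]
      by (smt (verit))
    have "norm (mollify (k \<epsilon>) w x - w x) powr q
        \<le> (2 * M) powr (q - 1) * norm (mollify (k \<epsilon>) w x - w x)" for x
    proof (cases "mollify (k \<epsilon>) w x = w x")
      case False
      then have "norm (mollify (k \<epsilon>) w x - w x) powr q
          = norm (mollify (k \<epsilon>) w x - w x) powr (q - 1) * norm (mollify (k \<epsilon>) w x - w x)"
        by (simp add: powr_diff)
      also have "\<dots> \<le> (2 * M) powr (q - 1) * norm (mollify (k \<epsilon>) w x - w x)"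
        using q le by (intro mult_right_mono powr_mono2) auto
      finally show ?thesis .
    qed simp
    then have "(\<integral>\<^sup>+x\<in>S. ennreal (norm (mollify (k \<epsilon>) w x - w x) powr q) \<partial>lborel)
        \<le> (\<integral>\<^sup>+x. c * (ennreal (norm (mollify (k \<epsilon>) w x - w x)) * indicator S x) \<partial>lborel)"
      unfolding c_def by (intro nn_integral_mono) (auto simp: indicator_def ennreal_leI simp flip: ennreal_mult)
    also have "\<dots> = c * (\<integral>\<^sup>+x\<in>S. ennreal (norm (mollify (k \<epsilon>) w x - w x)) \<partial>lborel)"
      by (rule nn_integral_cmult) measurable
    finally show ?thesis .
  qed
  have "((\<lambda>\<epsilon>. c * (\<integral>\<^sup>+x\<in>S. ennreal (norm (mollify (k \<epsilon>) w x - w x)) \<partial>lborel)) \<longlongrightarrow> c * 0) (at_right 0)"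
    by (intro ennreal_tendsto_cmult mollify_tendsto_L1[OF k w M S]) (auto simp: c_def)
  then have "((\<lambda>\<epsilon>. c * (\<integral>\<^sup>+x\<in>S. ennreal (norm (mollify (k \<epsilon>) w x - w x)) \<partial>lborel)) \<longlongrightarrow> 0) (at_right 0)"
    by simp
  then show ?thesis
    by (rule tendsto_sandwich[OF _ _ tendsto_const, rotated 2])
       (use bound in \<open>auto simp: eventually_at_right_field intro!: exI[of _ 1]\<close>)
qed

section \<open>Representatives of functions on an open set\<close>

lemma AE_lebesgue_on_iff_lborel:
  assumes "S \<in> sets borel"
  shows "(AE x in lebesgue_on S. P x) \<longleftrightarrow> (AE x in lborel. x \<in> S \<longrightarrow> P x)"
  using assms by (simp add: AE_restrict_space_iff AE_completion_iff)

lemma borel_representative: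
  fixes u :: "real ^ 'n \<Rightarrow> real"
  assumes U: "U \<in> sets borel" and u: "u \<in> borel_measurable (lebesgue_on U)"
  obtains u' where "u' \<in> borel_measurable borel" "AE x in lborel. x \<in> U \<longrightarrow> u' x = u x"
proof -
  have "(\<lambda>x. if x \<in> U then u x else 0) \<in> borel_measurable lebesgue"
    using U u by (subst borel_measurable_if) auto
  then obtain u' where u': "u' \<in> borel_measurable lborel"
    "AE x in lborel. (if x \<in> U then u x else 0) = u' x"
    using completion_ex_borel_measurable_real by blast
  from u'(2) have "AE x in lborel. x \<in> U \<longrightarrow> u' x = u x"
    by eventually_elim auto
  then show ?thesis using that u'(1) by auto
qed

lemma bounded_borel_representative:
  fixes u :: "real ^ 'n \<Rightarrow> real"
  assumes U: "U \<in> sets borel" and u: "u \<in> borel_measurable (lebesgue_on U)"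
    and B: "AE x in lebesgue_on U. \<bar>u x\<bar> \<le> B"
  obtains u' where "u' \<in> borel_measurable borel" "\<And>x. \<bar>u' x\<bar> \<le> max B 0"
    "AE x in lborel. x \<in> U \<longrightarrow> u' x = u x"
proof -
  obtain r where r [measurable]: "r \<in> borel_measurable borel" and ae: "AE x in lborel. x \<in> U \<longrightarrow> r x = u x"
    using borel_representative[OF U u] by blast
  define u' where "u' x = (if \<bar>r x\<bar> \<le> B then r x else 0)" for x
  have "AE x in lborel. x \<in> U \<longrightarrow> \<bar>u x\<bar> \<le> B"
    using B by (simp add: AE_lebesgue_on_iff_lborel[OF U])
  with ae have "AE x in lborel. x \<in> U \<longrightarrow> u' x = u x"
    by eventually_elim (auto simp: u'_def)
  moreover have "u' \<in> borel_measurable borel" unfolding u'_def by measurable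
  moreover have "\<bar>u' x\<bar> \<le> max B 0" for x by (auto simp: u'_def)
  ultimately show ?thesis using that by blast
qed

text \<open>
  Having unit length at every point of \<open>U\<close>, and not only almost everywhere, makes the pointwise
  bounds available at every point of the smaller set.
\<close>
lemma unit_field_borel_representative:
  fixes v :: "real ^ 'n \<Rightarrow> real ^ 'n"
  assumes U: "U \<in> sets borel" and v: "v \<in> borel_measurable (lebesgue_on U)"
    and unit: "AE x in lebesgue_on U. norm (v x) = 1"
  obtains w where "w \<in> borel_measurable borel" "\<And>x. norm (w x) \<le> 1" "\<And>x. x \<in> U \<Longrightarrow> norm (w x) = 1"
    "AE x in lborel. x \<in> U \<longrightarrow> w x = v x"
proof -
  have "\<forall>i. \<exists>r. r \<in> borel_measurable borel \<and> (AE x in lborel. x \<in> U \<longrightarrow> r x = v x $ i)"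
    using borel_representative[OF U borel_measurable_nth[OF v]] by blast
  from choice[OF this] obtain r where
    r': "\<forall>i. r i \<in> borel_measurable borel \<and> (AE x in lborel. x \<in> U \<longrightarrow> r i x = v x $ i)"
    by (rule exE)
  have r [measurable]: "r i \<in> borel_measurable borel" for i using r' by simp
  have ri: "AE x in lborel. x \<in> U \<longrightarrow> r i x = v x $ i" for i using r' by simp
  define r' :: "real ^ 'n \<Rightarrow> real ^ 'n" where "r' x = (\<chi> i. r i x)" for x
  have r' [measurable]: "r' \<in> borel_measurable borel"
    by (subst borel_measurable_euclidean_space) (auto simp: r'_def Basis_vec_def inner_axis)
  \<comment> \<open>\<open>axis undefined 1\<close> is some unit vector, used on a null set.\<close>
  define w where "w x = (if x \<in> U then if norm (r' x) = 1 then r' x else axis undefined 1 else 0)" for x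
  have "AE x in lborel. \<forall>i. x \<in> U \<longrightarrow> r i x = v x $ i"
    using ri by (intro eventually_all_finite)
  moreover have "AE x in lborel. x \<in> U \<longrightarrow> norm (v x) = 1"
    using unit by (simp add: AE_lebesgue_on_iff_lborel[OF U])
  ultimately have "AE x in lborel. x \<in> U \<longrightarrow> w x = v x"
  proof eventually_elim
    case (elim x)
    then have "r' x = v x" if "x \<in> U" using that by (simp add: r'_def vec_eq_iff)
    then show ?case using elim by (simp add: w_def)
  qed
  moreover have "w \<in> borel_measurable borel" unfolding w_def using U by measurable
  moreover have "norm (w x) \<le> 1" "x \<in> U \<Longrightarrow> norm (w x) = 1" for x by (auto simp: w_def)
  ultimately show ?thesis using that by blast
qed

lemma test_functions_mono: "U \<subseteq> V \<Longrightarrow> test_functions U \<subseteq> test_functions V"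
  unfolding test_functions_def compactly_contained_def by blast

lemma has_weak_gradient_subset:
  assumes g: "has_weak_gradient \<Omega> f g" and V: "V \<subseteq> \<Omega>"
  shows "has_weak_gradient V f g"
  unfolding has_weak_gradient_def
proof (intro conjI ballI allI)
  show "f \<in> L1_loc V" "g \<in> L1_loc V"
    using g V unfolding has_weak_gradient_def L1_loc_def by blast+
  fix \<eta> :: "real ^ 'a \<Rightarrow> real" and i assume \<eta>: "\<eta> \<in> test_functions V"
  obtain K where K: "K \<subseteq> V" "\<And>x. x \<notin> K \<Longrightarrow> \<eta> x = 0"
    "\<And>x i. x \<notin> K \<Longrightarrow> partial_deriv i \<eta> x = 0"
    using test_function_support[OF \<eta>] by metis
  have "\<eta> \<in> test_functions \<Omega>" using \<eta> test_functions_mono[OF V] by blast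
  then have "(LINT x:\<Omega>|lebesgue. f x * partial_deriv i \<eta> x) = - (LINT x:\<Omega>|lebesgue. g x $ i * \<eta> x)"
    using g unfolding has_weak_gradient_def by blast
  moreover have "indicat_real V x *\<^sub>R (f x * partial_deriv i \<eta> x)
      = indicat_real \<Omega> x *\<^sub>R (f x * partial_deriv i \<eta> x)"
    "indicat_real V x *\<^sub>R (g x $ i * \<eta> x) = indicat_real \<Omega> x *\<^sub>R (g x $ i * \<eta> x)" for x
    using K(1) K(2,3)[of x] V by (cases "x \<in> K"; auto simp: indicator_def)+
  ultimately show "(LINT x:V|lebesgue. f x * partial_deriv i \<eta> x) = - (LINT x:V|lebesgue. g x $ i * \<eta> x)"
    unfolding set_lebesgue_integral_def by (simp only:)
qed

lemma set_integral_lebesgue_eq_representative: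
  fixes u f \<phi> :: "real ^ 'n \<Rightarrow> real"
  assumes U: "U \<in> sets borel" and u: "u \<in> borel_measurable (lebesgue_on U)"
    and f [measurable]: "f \<in> borel_measurable borel" and ae: "AE x in lborel. x \<in> U \<longrightarrow> f x = u x"
    and \<phi> [measurable]: "\<phi> \<in> borel_measurable borel" and out: "\<And>x. x \<notin> U \<Longrightarrow> \<phi> x = 0"
  shows "(LINT x:U|lebesgue. u x * \<phi> x) = (LINT x|lborel. f x * \<phi> x)"
proof -
  have "(LINT x:U|lebesgue. u x * \<phi> x) = (LINT x|lebesgue. (if x \<in> U then u x else 0) * \<phi> x)"
    unfolding set_lebesgue_integral_def by (intro Bochner_Integration.integral_cong) auto
  also have "\<dots> = (LINT x|lebesgue. f x * \<phi> x)"
  proof (rule integral_cong_AE)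
    have "(\<lambda>x. if x \<in> U then u x else 0) \<in> borel_measurable lebesgue"
      using U u by (subst borel_measurable_if) auto
    then show "(\<lambda>x. (if x \<in> U then u x else 0) * \<phi> x) \<in> borel_measurable lebesgue"
      using measurable_completion[of \<phi> lborel borel] by (intro borel_measurable_times) auto
    show "(\<lambda>x. f x * \<phi> x) \<in> borel_measurable lebesgue"
      by (intro measurable_completion) measurable
    show "AE x in lebesgue. (if x \<in> U then u x else 0) * \<phi> x = f x * \<phi> x"
      unfolding AE_completion_iff using ae by eventually_elim (auto simp: out)
  qed
  also have "\<dots> = (LINT x|lborel. f x * \<phi> x)"
    by (rule integral_completion) measurable
  finally show ?thesis .
qed

lemma bounded_in_Lp:
  fixes u :: "real ^ 'n \<Rightarrow> 'b::real_normed_vector"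
  assumes V: "V \<in> sets borel" "bounded V" and u: "u \<in> borel_measurable (lebesgue_on V)"
    and B: "AE x in lebesgue_on V. norm (u x) \<le> B" and q: "0 \<le> q"
  shows "u \<in> Lp V q"
  unfolding Lp_def
proof (intro CollectI conjI u)
  have "(\<integral>\<^sup>+x\<in>V. ennreal (norm (u x) powr q) \<partial>lebesgue)
      = (\<integral>\<^sup>+x\<in>V. ennreal (norm (u x) powr q) \<partial>lborel)"
    by (rule nn_integral_completion)
  also have "\<dots> \<le> (\<integral>\<^sup>+x. ennreal (B powr q) * indicator V x \<partial>lborel)"
  proof (rule nn_integral_mono_AE)
    have "AE x in lborel. x \<in> V \<longrightarrow> norm (u x) \<le> B"
      using B by (simp add: AE_lebesgue_on_iff_lborel[OF V(1)])
    then show "AE x in lborel. ennreal (norm (u x) powr q) * indicator V x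
        \<le> ennreal (B powr q) * indicator V x"
      by eventually_elim (use q in \<open>auto simp: indicator_def intro!: ennreal_leI powr_mono2\<close>)
  qed
  also have "\<dots> = ennreal (B powr q) * emeasure lborel V"
    using V by (simp add: nn_integral_cmult_indicator)
  also have "\<dots> < \<infinity>"
    using emeasure_bounded_finite[OF V(2)] by (simp add: ennreal_mult_less_top)
  finally show "(\<integral>\<^sup>+x\<in>V. ennreal (norm (u x) powr q) \<partial>lebesgue) < \<infinity>" .
qed

lemma compactly_contained_neighbourhood:
  fixes \<Omega> :: "(real ^ 'n) set"
  assumes "open \<Omega>" "V \<subset>\<subset> \<Omega>"
  obtains U d where "open U" "U \<subset>\<subset> \<Omega>" "0 < d" "\<And>x. x \<in> closure V \<Longrightarrow> ball x d \<subseteq> U"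
proof -
  have K: "compact (closure V)" "closure V \<subseteq> \<Omega>"
    using assms by (auto simp only: compactly_contained_def)
  obtain d where d: "0 < d" "(\<Union>x\<in>closure V. cball x d) \<subseteq> \<Omega>"
    using compact_subset_open_imp_cball_epsilon_subset[OF K(1) assms(1) K(2)] by blast
  let ?U = "\<Union>x\<in>closure V. ball x d"
  have "(\<Union>x\<in>closure V. cball x d) = {x + y |x y. x \<in> closure V \<and> y \<in> cball 0 d}"
    by (force simp: dist_norm norm_minus_commute intro: exI[of _ "_ - _"])
  moreover have "compact {x + y |x y. x \<in> closure V \<and> y \<in> cball 0 d}"
    by (rule compact_sums[OF K(1) compact_cball])
  ultimately have C: "compact (\<Union>x\<in>closure V. cball x d)" by simp
  have "?U \<subseteq> (\<Union>x\<in>closure V. cball x d)"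
    using ball_subset_cball by blast
  then have cl: "closure ?U \<subseteq> (\<Union>x\<in>closure V. cball x d)"
    by (rule closure_minimal[OF _ compact_imp_closed[OF C]])
  then have "compact (closure ?U)"
    using compact_Int_closed[OF C closed_closure, of ?U] by (simp only: Int_absorb1)
  then have "?U \<subset>\<subset> \<Omega>"
    unfolding compactly_contained_def using cl d(2) by blast
  then show ?thesis
    using that[of ?U d] d(1) by blast
qed

section \<open>The recovery family\<close>

text \<open>
  The situation after localisation: \<open>V\<close> is the set on which the energies are computed, \<open>U\<close> contains
  the \<open>d\<close>-neighbourhood of its closure, \<open>v\<close> is the weak gradient of \<open>\<psi>\<close>, and \<open>f\<close> and \<open>w\<close> are the
  bounded Borel representatives of \<open>\<psi>\<close> and \<open>v\<close>.
\<close>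
locale eikonal_field =
  fixes U V :: "(real ^ 'n) set" and \<psi> f :: "real ^ 'n \<Rightarrow> real" and v w :: "real ^ 'n \<Rightarrow> real ^ 'n"
    and B d :: real
  assumes U: "open U" and V: "open V" "bounded V" and d: "0 < d"
    and near: "\<And>x. x \<in> closure V \<Longrightarrow> ball x d \<subseteq> U"
    and weak: "has_weak_gradient U \<psi> v"
    and psi: "\<psi> \<in> borel_measurable (lebesgue_on U)" and v: "v \<in> borel_measurable (lebesgue_on U)"
    and f [measurable]: "f \<in> borel_measurable borel" and f_le: "\<And>x. \<bar>f x\<bar> \<le> B"
    and f_ae: "AE x in lborel. x \<in> U \<longrightarrow> f x = \<psi> x"
    and w [measurable]: "w \<in> borel_measurable borel" and w_le: "\<And>x. norm (w x) \<le> 1"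
    and w_unit: "\<And>x. x \<in> U \<Longrightarrow> norm (w x) = 1"
    and w_ae: "AE x in lborel. x \<in> U \<longrightarrow> w x = v x"
begin

lemma closure_V_subset: "closure V \<subseteq> U"
  using near d by (meson centre_in_ball subsetD subsetI)

lemma V_subset: "V \<subseteq> U"
  using closure_V_subset closure_subset by blast

lemma V_borel [measurable]: "V \<in> sets borel" using V by simp

lemma U_borel: "U \<in> sets borel" using U by simp

lemma weak_gradient_lborel:
  assumes \<eta>: "\<eta> \<in> test_functions U"
  shows "(LINT x|lborel. f x * partial_deriv i \<eta> x) = - (LINT x|lborel. w x $ i * \<eta> x)"
proof -
  obtain K where K: "K \<subseteq> U" "\<And>x. x \<notin> K \<Longrightarrow> \<eta> x = 0" "\<And>x i. x \<notin> K \<Longrightarrow> partial_deriv i \<eta> x = 0"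
    using test_function_support[OF \<eta>] by metis
  have out: "\<eta> x = 0" "partial_deriv i \<eta> x = 0" if "x \<notin> U" for x
    using K that by blast+
  have wi: "AE x in lborel. x \<in> U \<longrightarrow> w x $ i = v x $ i"
    using w_ae by eventually_elim auto
  have "(LINT x:U|lebesgue. \<psi> x * partial_deriv i \<eta> x) = - (LINT x:U|lebesgue. v x $ i * \<eta> x)"
    using weak \<eta> unfolding has_weak_gradient_def by blast
  moreover have "(LINT x:U|lebesgue. \<psi> x * partial_deriv i \<eta> x) = (LINT x|lborel. f x * partial_deriv i \<eta> x)"
    by (rule set_integral_lebesgue_eq_representative[OF U_borel psi f f_ae
          test_function_partial_measurable[OF \<eta>] out(2)])
  moreover have "(LINT x:U|lebesgue. v x $ i * \<eta> x) = (LINT x|lborel. w x $ i * \<eta> x)"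
    by (rule set_integral_lebesgue_eq_representative[OF U_borel borel_measurable_nth[OF v]
          borel_measurable_nth[OF w] wi test_function_measurable[OF \<eta>] out(1)])
  ultimately show ?thesis by simp
qed

lemma AE_V: "AE x in lborel. x \<in> V \<longrightarrow> f x = \<psi> x \<and> w x = v x"
  using f_ae w_ae by eventually_elim (use V_subset in auto)

lemma psi_W1:
  assumes "1 \<le> q"
  shows "\<psi> \<in> W1 V q"
proof -
  have meas: "\<psi> \<in> borel_measurable (lebesgue_on V)" "v \<in> borel_measurable (lebesgue_on V)"
    using psi v V_subset U_borel V_borel
    by (auto intro: measurable_restrict_mono)
  have "AE x in lebesgue_on V. norm (\<psi> x) \<le> B" "AE x in lebesgue_on V. norm (v x) \<le> 1"
    unfolding AE_lebesgue_on_iff_lborel[OF V_borel]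
    by (use AE_V in eventually_elim, use f_le w_le in \<open>metis real_norm_def\<close>)+
  then have "\<psi> \<in> Lp V q" "v \<in> Lp V q"
    using meas assms V by (auto intro!: bounded_in_Lp)
  then show ?thesis
    unfolding W1_def using has_weak_gradient_subset[OF weak V_subset] by blast
qed

end

locale mollified_eikonal_field = eikonal_field U V \<psi> f v w B d + mollifier A \<epsilon> k dk
  for U V :: "(real ^ 'n) set" and \<psi> f :: "real ^ 'n \<Rightarrow> real" and v w :: "real ^ 'n \<Rightarrow> real ^ 'n"
    and B d A \<epsilon> :: real and k :: "real ^ 'n \<Rightarrow> real" and dk :: "real ^ 'n \<Rightarrow> real ^ 'n" +
  assumes eps_less: "\<epsilon> < d"
begin

lemma near_V: "x \<in> V \<Longrightarrow> norm z < \<epsilon> \<Longrightarrow> x + z \<in> U"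
  using near[of x] closure_subset[of V] eps_less by (auto simp: subset_iff dist_norm)

lemma weak_gradient_mollified: "has_weak_gradient V (mollify k f) (mollify k w)"
proof (rule weak_gradient_mollify[where M="max B 1" and U=U and r=\<epsilon>])
  show "\<bar>f x\<bar> \<le> max B 1" "norm (w x) \<le> max B 1" for x
    using f_le[of x] w_le[of x] by auto
qed (use k_integrable k_support near_V weak_gradient_lborel in auto)

lemma weak_hessian_mollified:
  "has_weak_hessian V (mollify k f) (mollify k w)
    (\<lambda>x. \<chi> i j. - mollify (\<lambda>z. dk z $ j) (\<lambda>y. w y $ i) x)"
proof -
  have wi: "\<bar>w y $ i\<bar> \<le> 1" for y i
    using component_le_norm_cart[of "w y" i] w_le[of y] by linarith
  have "has_weak_gradient V (\<lambda>x. mollify k w x $ i)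
      (\<lambda>x. \<chi> j. - mollify (\<lambda>z. dk z $ j) (\<lambda>y. w y $ i) x)" for i
    unfolding mollify_nth[OF k_integrable w w_le]
    by (rule weak_gradient_mollify_kernel[OF der dk_cont k_support dk_support borel_measurable_nth[OF w] wi])
  then show ?thesis
    unfolding has_weak_hessian_def using weak_gradient_mollified by simp
qed

lemma mollified_W1:
  assumes "1 \<le> q"
  shows "mollify k f \<in> W1 V q"
proof -
  have "mollify k f \<in> Lp V q"
  proof (rule bounded_in_Lp)
    show "mollify k f \<in> borel_measurable (lebesgue_on V)"
      by (intro measurable_restrict_space1 measurable_completion) (simp add: mollify_measurable)
    show "AE x in lebesgue_on V. norm (mollify k f x) \<le> B * (LINT z|lborel. \<bar>k z\<bar>)"
      using f_le by (intro AE_I2 mollify_norm_le k_integrable f) auto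
  qed (use V assms in auto)
  moreover have "mollify k w \<in> Lp V q"
  proof (rule bounded_in_Lp)
    show "mollify k w \<in> borel_measurable (lebesgue_on V)"
      by (intro measurable_restrict_space1 measurable_completion) (simp add: mollify_measurable)
    show "AE x in lebesgue_on V. norm (mollify k w x) \<le> 1"
      by (intro AE_I2 norm_mollify_le_1 w w_le)
  qed (use V assms in auto)
  ultimately show ?thesis
    unfolding W1_def using weak_gradient_mollified by blast
qed

text \<open>
  The pointwise bounds, integrated for the Borel representative \<open>w\<close>. The constant can be taken out
  of the integral because the inner integral \<open>D\<close> of \<open>w\<close> is a Borel function; only then is \<open>w\<close> replaced
  by \<open>v\<close>, which changes neither integral.
\<close>
lemma energy_mollified_le:
  "energy3 V \<epsilon> (mollify k f) \<le> ennreal (recovery_constant CARD('n) A) * (\<integral>\<^sup>+x\<in>closure V. (\<integral>\<^sup>+y\<in>ball x \<epsilon>.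
    ennreal (1 / \<epsilon> ^ CARD('n) * (norm (v y - v x) ^ 3 / norm (y - x))) \<partial>lebesgue) \<partial>lebesgue)"
proof -
  define D where "D x = (\<integral>\<^sup>+y\<in>ball x \<epsilon>.
    ennreal (1 / \<epsilon> ^ CARD('n) * (norm (w y - w x) ^ 3 / norm (y - x))) \<partial>lborel)" for x
  have "D = (\<lambda>x. \<integral>\<^sup>+y. ennreal (1 / \<epsilon> ^ CARD('n) * (norm (w y - w x) ^ 3 / norm (y - x)))
      * (if dist x y < \<epsilon> then 1 else 0) \<partial>lborel)"
    unfolding D_def by (intro ext nn_integral_cong) (simp add: indicator_def)
  also have "\<dots> \<in> borel_measurable borel" by measurable
  finally have [measurable]: "D \<in> borel_measurable borel" .
  let ?C = "recovery_constant CARD('n) A"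
  have C: "0 \<le> ?C" using recovery_constant_pos[OF A_pos] by (rule less_imp_le)
  let ?H = "\<lambda>x. \<chi> i j. - mollify (\<lambda>z. dk z $ j) (\<lambda>y. w y $ i) x"
  let ?e = "\<lambda>x. \<epsilon>\<^sup>2 * norm (?H x) ^ 3 + 1 / \<epsilon> * \<bar>1 - (norm (mollify k w x))\<^sup>2\<bar> powr (3 / 2)"
  have density: "ennreal (?e x) \<le> ennreal ?C * D x" if x: "x \<in> V" for x
  proof -
    interpret mollified_unit_field A \<epsilon> k dk w x "w x"
    proof
      show "norm (w y) = 1" if "y \<in> ball x \<epsilon>" for y
        using near_V[OF x, of "y - x"] that by (intro w_unit) (auto simp: dist_norm norm_minus_commute)
    qed (use w_le w in auto)
    have "ennreal (?e x) \<le> ennreal (?C * (osc / \<epsilon> ^ Suc CARD('n)))"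
      by (intro ennreal_leI energy_density_le)
    also have "\<dots> = ennreal ?C * ennreal (osc / \<epsilon> ^ Suc CARD('n))"
      using C by (rule ennreal_mult')
    also have "\<dots> \<le> ennreal ?C * D x"
      unfolding D_def by (intro mult_left_mono osc_le_nn_integral) auto
    finally show ?thesis .
  qed
  have "energy3 V \<epsilon> (mollify k f) \<le> (\<integral>\<^sup>+x\<in>V. ennreal (?e x) \<partial>lebesgue)"
    unfolding energy3_def
    by (rule INF_lower2[of "(mollify k w, ?H)"]) (use weak_hessian_mollified in auto)
  also have "\<dots> = (\<integral>\<^sup>+x\<in>V. ennreal (?e x) \<partial>lborel)"
    by (rule nn_integral_completion)
  also have "\<dots> \<le> (\<integral>\<^sup>+x. ennreal ?C * (D x * indicator (closure V) x) \<partial>lborel)"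
    by (intro nn_integral_mono) (use density closure_subset[of V] in \<open>auto simp: indicator_def\<close>)
  also have "\<dots> = ennreal ?C * (\<integral>\<^sup>+x\<in>closure V. D x \<partial>lborel)"
    by (rule nn_integral_cmult) measurable
  also have "(\<integral>\<^sup>+x\<in>closure V. D x \<partial>lborel) = (\<integral>\<^sup>+x\<in>closure V. (\<integral>\<^sup>+y\<in>ball x \<epsilon>.
    ennreal (1 / \<epsilon> ^ CARD('n) * (norm (v y - v x) ^ 3 / norm (y - x))) \<partial>lebesgue) \<partial>lborel)"
  proof (rule nn_integral_cong_AE, use w_ae in eventually_elim)
    case (elim x)
    show ?case
    proof (cases "x \<in> closure V")
      case True
      have sub: "ball x \<epsilon> \<subseteq> U" using near[OF True] eps_less by auto
      have "w x = v x" using elim True closure_V_subset by blast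
      have "D x = (\<integral>\<^sup>+y\<in>ball x \<epsilon>.
          ennreal (1 / \<epsilon> ^ CARD('n) * (norm (v y - v x) ^ 3 / norm (y - x))) \<partial>lborel)"
        unfolding D_def \<open>w x = v x\<close>
        by (rule nn_integral_cong_AE, use w_ae in eventually_elim)
           (use sub in \<open>auto simp: indicator_def\<close>)
      then show ?thesis by (simp only: nn_integral_completion)
    qed simp
  qed
  finally show ?thesis by (simp only: nn_integral_completion)
qed

end

context eikonal_field
begin

text \<open>
  For \<open>\<epsilon> \<ge> d\<close> the balls around points of \<open>V\<close> may leave \<open>U\<close>, where \<open>f\<close> is unrelated to \<open>\<psi>\<close>. The
  family must nevertheless lie in \<open>W\<^sup>1\<^sup>,\<^sup>q\<close> for every \<open>\<epsilon>\<close>, so it is continued by \<open>\<psi>\<close> itself.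
\<close>
lemma recovery_W1_tendsto:
  fixes k :: "real \<Rightarrow> real ^ 'n \<Rightarrow> real"
  assumes k: "\<And>\<epsilon>. 0 < \<epsilon> \<Longrightarrow> mollifier A \<epsilon> (k \<epsilon>) (dk \<epsilon>)" and q: "1 \<le> q"
  shows "W1_tendsto V q (\<lambda>\<epsilon>. if \<epsilon> < d then mollify (k \<epsilon>) f else \<psi>) \<psi>"
proof -
  let ?u = "\<lambda>\<epsilon>. if \<epsilon> < d then mollify (k \<epsilon>) f else \<psi>"
  let ?G = "\<lambda>\<epsilon>. if \<epsilon> < d then mollify (k \<epsilon>) w else v"
  have moll: "mollified_eikonal_field U V \<psi> f v w B d A \<epsilon> (k \<epsilon>) (dk \<epsilon>)" if "0 < \<epsilon>" "\<epsilon> < d" for \<epsilon>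
    by (intro mollified_eikonal_field.intro eikonal_field_axioms k that
        mollified_eikonal_field_axioms.intro)
  have wg: "has_weak_gradient V \<psi> v"
    by (rule has_weak_gradient_subset[OF weak V_subset])
  have W: "?u \<epsilon> \<in> W1 V q" if "0 < \<epsilon>" for \<epsilon>
    using psi_W1[OF q] mollified_eikonal_field.mollified_W1[OF moll q] that by auto
  have G: "has_weak_gradient V (?u \<epsilon>) (?G \<epsilon>)" if "0 < \<epsilon>" for \<epsilon>
    using wg mollified_eikonal_field.weak_gradient_mollified[OF moll] that by auto
  have eq: "(\<integral>\<^sup>+x\<in>V. ennreal (\<bar>?u \<epsilon> x - \<psi> x\<bar> powr q + norm (?G \<epsilon> x - v x) powr q) \<partial>lebesgue)
      = (\<integral>\<^sup>+x\<in>V. ennreal (norm (mollify (k \<epsilon>) f x - f x) powr q) \<partial>lborel)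
        + (\<integral>\<^sup>+x\<in>V. ennreal (norm (mollify (k \<epsilon>) w x - w x) powr q) \<partial>lborel)" if "0 < \<epsilon>" "\<epsilon> < d" for \<epsilon>
  proof -
    interpret mollified_eikonal_field U V \<psi> f v w B d A \<epsilon> "k \<epsilon>" "dk \<epsilon>" by (rule moll[OF that])
    note [measurable] = mollify_measurable[OF k_measurable f] mollify_measurable[OF k_measurable w]
    have "(\<integral>\<^sup>+x\<in>V. ennreal (\<bar>?u \<epsilon> x - \<psi> x\<bar> powr q + norm (?G \<epsilon> x - v x) powr q) \<partial>lebesgue)
      = (\<integral>\<^sup>+x\<in>V. ennreal (\<bar>?u \<epsilon> x - \<psi> x\<bar> powr q + norm (?G \<epsilon> x - v x) powr q) \<partial>lborel)"
      by (rule nn_integral_completion)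
    also have "\<dots> = (\<integral>\<^sup>+x. ennreal (norm (mollify (k \<epsilon>) f x - f x) powr q) * indicator V x
        + ennreal (norm (mollify (k \<epsilon>) w x - w x) powr q) * indicator V x \<partial>lborel)"
      by (rule nn_integral_cong_AE, use AE_V in eventually_elim)
         (use that in \<open>auto simp: indicator_def\<close>)
    also have "\<dots> = (\<integral>\<^sup>+x\<in>V. ennreal (norm (mollify (k \<epsilon>) f x - f x) powr q) \<partial>lborel)
        + (\<integral>\<^sup>+x\<in>V. ennreal (norm (mollify (k \<epsilon>) w x - w x) powr q) \<partial>lborel)"
      by (rule nn_integral_add) measurable
    finally show ?thesis .
  qed
  have "((\<lambda>\<epsilon>. (\<integral>\<^sup>+x\<in>V. ennreal (norm (mollify (k \<epsilon>) f x - f x) powr q) \<partial>lborel)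
      + (\<integral>\<^sup>+x\<in>V. ennreal (norm (mollify (k \<epsilon>) w x - w x) powr q) \<partial>lborel)) \<longlongrightarrow> 0 + 0) (at_right 0)"
  proof (rule tendsto_add)
    show "((\<lambda>\<epsilon>. \<integral>\<^sup>+x\<in>V. ennreal (norm (mollify (k \<epsilon>) f x - f x) powr q) \<partial>lborel) \<longlongrightarrow> 0) (at_right 0)"
      using f_le by (intro mollify_tendsto_Lp[OF k f _ V(2) V_borel q, of B]) auto
    show "((\<lambda>\<epsilon>. \<integral>\<^sup>+x\<in>V. ennreal (norm (mollify (k \<epsilon>) w x - w x) powr q) \<partial>lborel) \<longlongrightarrow> 0) (at_right 0)"
      by (rule mollify_tendsto_Lp[OF k w w_le V(2) V_borel q])
  qed
  moreover have "\<forall>\<^sub>F \<epsilon> in at_right 0.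
      (\<integral>\<^sup>+x\<in>V. ennreal (norm (mollify (k \<epsilon>) f x - f x) powr q) \<partial>lborel)
        + (\<integral>\<^sup>+x\<in>V. ennreal (norm (mollify (k \<epsilon>) w x - w x) powr q) \<partial>lborel)
      = (\<integral>\<^sup>+x\<in>V. ennreal (\<bar>?u \<epsilon> x - \<psi> x\<bar> powr q + norm (?G \<epsilon> x - v x) powr q) \<partial>lebesgue)"
    unfolding eventually_at_right_field using d eq[symmetric] by blast
  ultimately have "((\<lambda>\<epsilon>. \<integral>\<^sup>+x\<in>V. ennreal (\<bar>?u \<epsilon> x - \<psi> x\<bar> powr q + norm (?G \<epsilon> x - v x) powr q) \<partial>lebesgue)
      \<longlongrightarrow> 0 + 0) (at_right 0)"
    by (rule Lim_transform_eventually)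
  then show ?thesis
    unfolding W1_tendsto_def using psi_W1[OF q] W wg G
    by (intro conjI exI[of _ v] exI[of _ ?G]) auto
qed

lemma Gamma_limsup_le:
  fixes k :: "real \<Rightarrow> real ^ 'n \<Rightarrow> real"
  assumes k: "\<And>\<epsilon>. 0 < \<epsilon> \<Longrightarrow> mollifier A \<epsilon> (k \<epsilon>) (dk \<epsilon>)" and q: "1 \<le> q"
  shows "Gamma_limsup_W1 V q (energy3 V) \<psi>
    \<le> ennreal (recovery_constant CARD('n) A) * A3 (closure V) v"
proof -
  let ?C = "recovery_constant CARD('n) A"
  let ?u = "\<lambda>\<epsilon>. if \<epsilon> < d then mollify (k \<epsilon>) f else \<psi>"
  let ?T = "\<lambda>\<epsilon>. \<integral>\<^sup>+x\<in>closure V. (\<integral>\<^sup>+y\<in>ball x \<epsilon>.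
    ennreal (1 / \<epsilon> ^ CARD('n) * (norm (v y - v x) ^ 3 / norm (y - x))) \<partial>lebesgue) \<partial>lebesgue"
  have "Gamma_limsup_W1 V q (energy3 V) \<psi> \<le> Limsup (at_right 0) (\<lambda>\<epsilon>. energy3 V \<epsilon> (?u \<epsilon>))"
    unfolding Gamma_limsup_W1_def
    by (rule INF_lower) (use recovery_W1_tendsto[OF k q] in simp)
  also have "\<dots> \<le> Limsup (at_right 0) (\<lambda>\<epsilon>. ennreal ?C * ?T \<epsilon>)"
  proof (rule Limsup_mono)
    have "\<forall>\<^sub>F \<epsilon> in at_right 0. 0 < \<epsilon> \<and> \<epsilon> < d"
      using d by (auto simp: eventually_at_right_field)
    then show "\<forall>\<^sub>F \<epsilon> in at_right 0. energy3 V \<epsilon> (?u \<epsilon>) \<le> ennreal ?C * ?T \<epsilon>"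
    proof eventually_elim
      case (elim \<epsilon>)
      interpret mollified_eikonal_field U V \<psi> f v w B d A \<epsilon> "k \<epsilon>" "dk \<epsilon>"
        by (intro mollified_eikonal_field.intro eikonal_field_axioms k
            mollified_eikonal_field_axioms.intro) (use elim in auto)
      show ?case using energy_mollified_le elim by simp
    qed
  qed
  also have "\<dots> = ennreal ?C * Limsup (at_right 0) ?T"
  proof (rule Limsup_compose_continuous_mono)
    show "continuous_on UNIV (\<lambda>t. ennreal ?C * t)"
      unfolding continuous_on_def by (auto intro!: ennreal_tendsto_cmult tendsto_ident_at)
    show "mono (\<lambda>t. ennreal ?C * t)" by (auto intro!: monoI mult_left_mono)
  qed simp
  finally show ?thesis by (simp add: A3_def)
qed

text \<open>
  For \<open>\<epsilon> < min 1 d\<close> the balls around points of the closure of \<open>V\<close> lie in \<open>U\<close>, and then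
  the double integral at scale \<open>\<epsilon>\<close> is one of those in the supremum that defines \<open>A_bar3\<close>.
\<close>
lemma A3_le_A_bar3: "A3 (closure V) v \<le> A_bar3 U v"
  unfolding A3_def
proof (rule Limsup_bounded)
  have "\<forall>\<^sub>F \<epsilon> in at_right 0. 0 < \<epsilon> \<and> \<epsilon> < min 1 d"
    using d by (auto simp: eventually_at_right_field intro!: exI[of _ "min 1 d"])
  then show "\<forall>\<^sub>F \<epsilon> in at_right 0. (\<integral>\<^sup>+x\<in>closure V. (\<integral>\<^sup>+y\<in>ball x \<epsilon>.
    ennreal (1 / \<epsilon> ^ CARD('n) * (norm (v y - v x) ^ 3 / norm (y - x))) \<partial>lebesgue) \<partial>lebesgue) \<le> A_bar3 U v"
  proof eventually_elim
    case (elim \<epsilon>)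
    have "(\<integral>\<^sup>+x\<in>closure V. (\<integral>\<^sup>+y\<in>ball x \<epsilon>.
        ennreal (1 / \<epsilon> ^ CARD('n) * (norm (v y - v x) ^ 3 / norm (y - x))) \<partial>lebesgue) \<partial>lebesgue)
      \<le> (\<integral>\<^sup>+x\<in>U. (\<integral>\<^sup>+y\<in>ball x \<epsilon> \<inter> U.
        ennreal (1 / \<epsilon> ^ CARD('n) * (norm (v y - v x) ^ 3 / norm (y - x))) \<partial>lebesgue) \<partial>lebesgue)"
    proof (rule nn_integral_mono)
      fix x
      show "(\<integral>\<^sup>+y\<in>ball x \<epsilon>. ennreal (1 / \<epsilon> ^ CARD('n) * (norm (v y - v x) ^ 3 / norm (y - x))) \<partial>lebesgue)
          * indicator (closure V) x
        \<le> (\<integral>\<^sup>+y\<in>ball x \<epsilon> \<inter> U. ennreal (1 / \<epsilon> ^ CARD('n) * (norm (v y - v x) ^ 3 / norm (y - x))) \<partial>lebesgue)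
          * indicator U x"
      proof (cases "x \<in> closure V")
        case True
        have "ball x \<epsilon> \<inter> U = ball x \<epsilon>" using near[OF True] elim by auto
        then show ?thesis using True closure_V_subset by (auto simp: indicator_def)
      qed simp
    qed
    also have "\<dots> \<le> A_bar3 U v"
      unfolding A_bar3_def by (rule SUP_upper) (use elim in auto)
    finally show ?case .
  qed
qed

end

theorem corollary1p1:
  shows "\<exists>C::real. C > 0 \<and>
    (\<forall>(\<Omega> :: (real ^ 'n) set) \<psi> grad_psi.
      open \<Omega> \<and> \<psi> \<in> W1inf_loc \<Omega> \<and> has_weak_gradient \<Omega> \<psi> grad_psi \<and>
      (AE x in lebesgue_on \<Omega>. norm (grad_psi x) = 1) \<and> grad_psi \<in> BV3_loc \<Omega> \<longrightarrow>
      (\<forall>\<Omega>' q. open \<Omega>' \<and> \<Omega>' \<subset>\<subset> \<Omega> \<and> (1::real) \<le> q \<longrightarrow>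
        \<psi> \<in> class_A \<Omega>' q \<and>
        Gamma_limsup_W1 \<Omega>' q (energy3 \<Omega>') \<psi> \<le> ennreal C * A3 (closure \<Omega>') grad_psi))"
proof -
  obtain A :: real where "\<And>\<epsilon>. 0 < \<epsilon> \<Longrightarrow> \<exists>(k :: real ^ 'n \<Rightarrow> real) dk. mollifier A \<epsilon> k dk"
    using mollifier_exists by blast
  then obtain k :: "real \<Rightarrow> real ^ 'n \<Rightarrow> real" and dk
    where k: "\<And>\<epsilon>. 0 < \<epsilon> \<Longrightarrow> mollifier A \<epsilon> (k \<epsilon>) (dk \<epsilon>)" by metis
  let ?C = "recovery_constant CARD('n) A"
  have "0 < A" using mollifier.A_pos[OF k[of 1]] by simp
  then have C: "0 < ?C" by (rule recovery_constant_pos)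
  have main: "\<psi> \<in> class_A V q \<and> Gamma_limsup_W1 V q (energy3 V) \<psi> \<le> ennreal ?C * A3 (closure V) v"
    if \<Omega>: "open \<Omega>" and psi: "\<psi> \<in> W1inf_loc \<Omega>" and weak: "has_weak_gradient \<Omega> \<psi> v"
      and unit: "AE x in lebesgue_on \<Omega>. norm (v x) = 1" and BV: "v \<in> BV3_loc \<Omega>"
      and V: "open V" "V \<subset>\<subset> \<Omega>" and q: "1 \<le> q"
    for \<Omega> V :: "(real ^ 'n) set" and \<psi> v and q :: real
  proof -
    obtain U d where U: "open U" "U \<subset>\<subset> \<Omega>" and d: "0 < d" "\<And>x. x \<in> closure V \<Longrightarrow> ball x d \<subseteq> U"
      using compactly_contained_neighbourhood[OF \<Omega> V(2)] by blast
    have Ub: "U \<in> sets borel" "\<Omega> \<in> sets borel" using U \<Omega> by simp_all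
    have sub: "U \<subseteq> \<Omega>" using U(2) closure_subset unfolding compactly_contained_def by blast
    have bV: "bounded V"
      using V(2) compact_imp_bounded bounded_subset closure_subset unfolding compactly_contained_def by metis
    have "\<psi> \<in> W1inf U" using psi U unfolding W1inf_loc_def by blast
    then obtain B where psi_m: "\<psi> \<in> borel_measurable (lebesgue_on U)"
      and B: "AE x in lebesgue_on U. norm (\<psi> x) \<le> B"
      unfolding W1inf_def Linf_def by blast
    have "v \<in> BV3 U" using BV U unfolding BV3_loc_def by blast
    then have v_m: "v \<in> borel_measurable (lebesgue_on U)" and fin: "A_bar3 U v < \<infinity>"
      unfolding BV3_def Lp_def by blast+
    have "AE x in lebesgue_on U. norm (v x) = 1"
      using unit sub unfolding AE_lebesgue_on_iff_lborel[OF Ub(1)] AE_lebesgue_on_iff_lborel[OF Ub(2)]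
      by (auto elim!: eventually_mono)
    then obtain w where w: "w \<in> borel_measurable borel" "\<And>x. norm (w x) \<le> 1" "\<And>x. x \<in> U \<Longrightarrow> norm (w x) = 1"
      "AE x in lborel. x \<in> U \<longrightarrow> w x = v x"
      using unit_field_borel_representative[OF Ub(1) v_m] by blast
    obtain f where f: "f \<in> borel_measurable borel" "\<And>x. \<bar>f x\<bar> \<le> max B 0"
      "AE x in lborel. x \<in> U \<longrightarrow> f x = \<psi> x"
      using bounded_borel_representative[OF Ub(1) psi_m B[unfolded real_norm_def]] by blast
    interpret eikonal_field U V \<psi> f v w "max B 0" d
      by (intro eikonal_field.intro U V bV d psi_m v_m f w has_weak_gradient_subset[OF weak sub])
    have bound: "Gamma_limsup_W1 V q (energy3 V) \<psi> \<le> ennreal ?C * A3 (closure V) v"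
      by (rule Gamma_limsup_le[OF k q])
    also have "\<dots> < \<infinity>"
      using A3_le_A_bar3 fin by (simp add: ennreal_mult_less_top order.strict_trans1)
    finally have "\<psi> \<in> class_A V q"
      unfolding class_A_def using psi_W1[OF q] by blast
    with bound show ?thesis by blast
  qed
  show ?thesis
    by (intro exI[of _ ?C] conjI C allI impI; elim conjE) (use main in blast)+
qed

end
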